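(* Let $(G,\sigma)$ be a signed graph with no digon and no positive loop that is (circular) $3$-critical, i.e. $\chi_c(G,\sigma)>3$ but $\chi_c(H,\sigma|_H)\le 3$ for every proper subgraph $H$ of $G$. Then $$|E(G)|\geq \frac{3|V(G)|-1}{2}.$$
   Context: All graphs are finite and may have multiple edges or loops. A signed graph $(G,\sigma)$ is a graph $G$ together with a signature $\sigma:E(G)\to\{+,-\}$; edges are called positive or negative accordingly. A digon is a pair of parallel edges with different signs. A subgraph $H$ of $G$ carries the restricted signature $\sigma|_H$. Given positive integers $p,q$ with $p\ge 2q$ and $p$ even, a circular $\frac{p}{q}$-coloring of $(G,\sigma)$ is a mapping $\varphi:V(G)\to\{0,1,\ldots,p-1\}$ such that (i) for each positive edge $uv$, $q\le|\varphi(u)-\varphi(v)|\le p-q$, and (ii) for each negative edge $uv$, either $|\varphi(u)-\varphi(v)|\le \frac p2-q$ or $|\varphi(u)-\varphi(v)|\ge\frac p2+q$. The circular chromatic number is $$\chi_c(G,\sigma)=\min\Big\{\tfrac pq \;\Big|\; (G,\sigma)\text{ admits a circular }\tfrac pq\text{-coloring}\Big\}.$$ *)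

theory Defs
  imports Complex_Main "HOL-Library.Uprod" "HOL-Library.Extended_Real"
begin

datatype edge_sign = Positive | Negative

(* The edge names are separate from their end-vertices, so parallel edges are allowed;
   a loop at v has ends "Upair v v". *)
record ('v, 'e) signed_graph =
  verts :: "'v set"
  edges :: "'e set"
  ends :: "'e \<Rightarrow> 'v uprod"
  signature :: "'e \<Rightarrow> edge_sign"

definition finite_signed_graph :: "('v, 'e) signed_graph \<Rightarrow> bool" where
  "finite_signed_graph G \<longleftrightarrow>
     finite (verts G) \<and> finite (edges G) \<and> (\<forall>e\<in>edges G. set_uprod (ends G e) \<subseteq> verts G)"

definition has_digon :: "('v, 'e) signed_graph \<Rightarrow> bool" where
  "has_digon G \<longleftrightarrow>
     (\<exists>e\<in>edges G. \<exists>f\<in>edges G. ends G e = ends G f \<and> signature G e \<noteq> signature G f)"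

definition has_positive_loop :: "('v, 'e) signed_graph \<Rightarrow> bool" where
  "has_positive_loop G \<longleftrightarrow>
     (\<exists>e\<in>edges G. signature G e = Positive \<and> (\<exists>v. ends G e = Upair v v))"

(* The values of ends and signature outside the edge set carry no meaning, so graphs are compared
   only on their vertices and edges. *)
definition subgraph :: "('v, 'e) signed_graph \<Rightarrow> ('v, 'e) signed_graph \<Rightarrow> bool" where
  "subgraph H G \<longleftrightarrow>
     finite_signed_graph H \<and> verts H \<subseteq> verts G \<and> edges H \<subseteq> edges G \<and>
     (\<forall>e\<in>edges H. ends H e = ends G e \<and> signature H e = signature G e)"

definition proper_subgraph :: "('v, 'e) signed_graph \<Rightarrow> ('v, 'e) signed_graph \<Rightarrow> bool" where
  "proper_subgraph H G \<longleftrightarrow> subgraph H G \<and> (verts H \<noteq> verts G \<or> edges H \<noteq> edges G)"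

definition circular_coloring :: "int \<Rightarrow> int \<Rightarrow> ('v, 'e) signed_graph \<Rightarrow> ('v \<Rightarrow> int) \<Rightarrow> bool" where
  "circular_coloring p q G \<phi> \<longleftrightarrow>
     (\<forall>v\<in>verts G. \<phi> v \<in> {0..p - 1}) \<and>
     (\<forall>e\<in>edges G. \<forall>u v. ends G e = Upair u v \<longrightarrow>
        (signature G e = Positive \<longrightarrow>
           q \<le> \<bar>\<phi> u - \<phi> v\<bar> \<and> \<bar>\<phi> u - \<phi> v\<bar> \<le> p - q) \<and>
        (signature G e = Negative \<longrightarrow>
           \<bar>\<phi> u - \<phi> v\<bar> \<le> p div 2 - q \<or> \<bar>\<phi> u - \<phi> v\<bar> \<ge> p div 2 + q))"

(* For a finite signed graph without positive loops this infimum is a minimum. A graph with a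
   positive loop has no circular coloring at all and gets the value \<infinity>. *)
definition circular_chromatic_number :: "('v, 'e) signed_graph \<Rightarrow> ereal" where
  "circular_chromatic_number G =
     Inf {ereal (real_of_int p / real_of_int q) | p q.
            0 < p \<and> 0 < q \<and> 2 * q \<le> p \<and> even p \<and> (\<exists>\<phi>. circular_coloring p q G \<phi>)}"

definition circular_critical :: "ereal \<Rightarrow> ('v, 'e) signed_graph \<Rightarrow> bool" where
  "circular_critical r G \<longleftrightarrow>
     circular_chromatic_number G > r \<and>
     (\<forall>H. proper_subgraph H G \<longrightarrow> circular_chromatic_number H \<le> r)"

end

(* A circular 3-colouring is a homomorphism to the hexagon Z_6 in which a negative edge joins colours
   at distance at most 1, a positive edge joins colours at distance at least 2, and switching a
   vertex is the antipodal map c -> c + 3.  A vertex of degree 2 only forbids one relative position of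
   its two neighbours, so it is replaced by a "weak" edge between them.  A strong edge weighs 2, a weak
   one 1, and the potential rho(S) = 3|S| - weight(S) is unchanged by this replacement.  The claim becomes: a
   critical graph other than a strong digon has potential at most 1.

   In a minimal counterexample, colouring a proper vertex set S and identifying its colour classes to
   a positive triangle gives a smaller critical graph, which bounds rho(S) from below.  Hence after deleting a few
   vertices one can add a strong edge, or a strong and a weak one, and still colour the rest; this
   restricts the neighbourhoods of vertices of small degree.  Counting weak
   edges half, only vertices with two strong edges and one weak edge have degree below 3, and their
   strong neighbours can pay for them, so the potential would be at most 0. *)
theory Submission imports Defs begin

section \<open>Colours\<close>

text \<open>With strong edges only, potential at most 1 reads 3|V| - 2|E| <= 1, which is the claim.
  Weak edges are more than a shorthand for vertices of degree 2: some gadgets have to impose a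
  constraint of weight 1, so the induction runs over mixed graphs from the start. The thresholds
  share one source. If a gadget of weight w creates a smaller critical graph of potential at most 1,
  removing the gadget leaves a set of potential at most 1 + w: 2 for a weak edge, 3 for a strong
  one, 4 for both. Proper nonempty sets have potential at least 3, and those of potential 3 are very
  special (\<open>rigid\<close>), which settles the first two cases. The third is refuted by putting
  the deleted vertices back and counting. The obstacle is the strong digon, whose potential is 2:
  when it arises in the quotient argument, the potential drops by 1 only instead of 2. It then comes
  from a single new vertex with two strong edges into the set, and this is carried along as an
  alternative. Signs are absorbed by \<open>flip\<close> into the colours of the neighbours, so the
  facts about colours can be stated for unsigned nearness.\<close>

datatype col = C0 | C1 | C2 | C3 | C4 | C5

fun rot :: "col \<Rightarrow> col" where
  "rot C0 = C1" | "rot C1 = C2" | "rot C2 = C3" | "rot C3 = C4" | "rot C4 = C5" | "rot C5 = C0"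

fun opp :: "col \<Rightarrow> col" where
  "opp C0 = C3" | "opp C1 = C4" | "opp C2 = C5" | "opp C3 = C0" | "opp C4 = C1" | "opp C5 = C2"

definition near :: "col \<Rightarrow> col \<Rightarrow> bool" where
  "near c d \<longleftrightarrow> c = d \<or> c = rot d \<or> d = rot c"

definition flip :: "bool \<Rightarrow> col \<Rightarrow> col" where
  "flip s c = (if s then opp c else c)"

text \<open>A strong edge leaves three consecutive colours to \<open>c\<close>, a weak one all but
  one. A flipped strong edge is a positive edge, because being near the antipode of \<open>d\<close>
  means being at distance at least 2 from \<open>d\<close>.\<close>

definition allow :: "bool \<Rightarrow> bool \<Rightarrow> col \<Rightarrow> col \<Rightarrow> bool" where
  "allow k s c d \<longleftrightarrow> (if k then near c (flip s d) else c \<noteq> opp (flip s d))"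

lemma UNIV_col: "(UNIV :: col set) = {C0, C1, C2, C3, C4, C5}"
  using col.exhaust by auto

lemma ex_col: "(\<exists>c. P c) \<longleftrightarrow> P C0 \<or> P C1 \<or> P C2 \<or> P C3 \<or> P C4 \<or> P C5"
  by (metis col.exhaust)

lemma all_col: "(\<forall>c. P c) \<longleftrightarrow> P C0 \<and> P C1 \<and> P C2 \<and> P C3 \<and> P C4 \<and> P C5"
  by (metis col.exhaust)

lemma opp_opp [simp]: "opp (opp c) = c"
  by (cases c) auto

lemma opp_inject [simp]: "opp c = opp d \<longleftrightarrow> c = d"
  by (metis opp_opp)

lemma near_commute: "near c d \<longleftrightarrow> near d c"
  by (auto simp: near_def)

lemma near_refl [simp]: "near c c"
  by (simp add: near_def)

lemma near_opp_opp [simp]: "near (opp c) (opp d) \<longleftrightarrow> near c d"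
  by (cases c; cases d) (auto simp: near_def)

lemma near_opp_iff: "near c (opp d) \<longleftrightarrow> near (opp c) d"
  using near_opp_opp[of "opp c" d] by simp

lemma flip_flip [simp]: "flip s (flip t c) = flip (s \<noteq> t) c"
  by (auto simp: flip_def)

lemma flip_inject [simp]: "flip s c = flip s d \<longleftrightarrow> c = d"
  by (auto simp: flip_def)

lemma flip_False [simp]: "flip False c = c"
  by (simp add: flip_def)

lemma opp_flip: "opp (flip s c) = flip (\<not> s) c"
  by (auto simp: flip_def)

lemma near_flip_flip: "near (flip s c) (flip t d) \<longleftrightarrow> near c (flip (s \<noteq> t) d)"
  by (auto simp: flip_def near_opp_iff)

lemma flip_eq_iff: "flip s c = flip t d \<longleftrightarrow> c = flip (s \<noteq> t) d"
  by (auto simp: flip_def)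

lemma allow_flip: "allow k (s \<noteq> t) c d \<longleftrightarrow> allow k False (flip s c) (flip t d)"
  by (auto simp: allow_def near_flip_flip opp_flip flip_eq_iff)

lemma allow_commute: "allow k s c d \<longleftrightarrow> allow k s d c"
  by (cases c; cases d) (auto simp: allow_def near_def flip_def)

lemma allow_near: "allow True False c d \<longleftrightarrow> near c d"
  by (simp add: allow_def)

lemma allow_not_opp: "allow False False c d \<longleftrightarrow> c \<noteq> opp d"
  by (simp add: allow_def)

lemma allow_not_both: "\<not> (allow True s c d \<and> allow True (\<not> s) c d)"
  by (cases c; cases d) (auto simp: allow_def near_def flip_def)

lemma card_forbidden: "card {c. \<not> allow k s c d} = (if k then 3 else 1)"
proof -
  have "{c. \<not> near c e} = {opp e, rot (opp e), rot (rot e)}" for e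
    unfolding set_eq_iff all_col by (cases e) (simp_all add: near_def)
  then have "card {c. \<not> near c e} = 3" for e
    by (cases e) simp_all
  then show ?thesis
    by (simp add: allow_def)
qed

section \<open>Completing a colouring at one vertex or along a positive triangle\<close>

lemma near_pair_extend:
  assumes "near a b"
  shows "\<exists>x. near x a \<and> near x b \<and> x \<noteq> opp c"
  using assms by (cases a; cases b; cases c; simp add: near_def ex_col)

text \<open>If \<open>b\<close> has position 0, these are (x, a) = (1, 2) and (5, 4). There are no
  other solutions: \<open>a\<close> is far from \<open>b\<close> but within two steps through
  \<open>x\<close>, so \<open>x\<close> is the midpoint. The next lemmas ask which further demands
  one of the two always meets.\<close>

lemma triangle_witnesses:
  "near (rot b) b" "near (rot b) (rot (rot b))" "\<not> near (rot (rot b)) b"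
  "near (opp (rot (rot b))) b" "near (opp (rot (rot b))) (opp (rot b))" "\<not> near (opp (rot b)) b"
  by (cases b; simp add: near_def)+

lemma triangle_extendI:
  assumes "P (rot b) (rot (rot b)) \<or> P (opp (rot (rot b))) (opp (rot b))"
  shows "\<exists>x a. near x b \<and> near x a \<and> \<not> near a b \<and> P x a"
  using assms triangle_witnesses[of b] by blast

text \<open>Both solutions avoid \<open>opp c\<close>, which is far from \<open>b\<close>. The
  candidates b + 2 and b - 2 for \<open>a\<close> are together near every colour except
  \<open>b\<close>.\<close>

lemma triangle_extend_strong:
  assumes "near c b" "z \<noteq> b"
  shows "\<exists>x a. near x b \<and> near x a \<and> \<not> near a b \<and> x \<noteq> opp c \<and> near a z"
  by (rule triangle_extendI) (use assms in \<open>cases b; cases c; simp add: near_def; cases z; simp\<close>)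

text \<open>Both solutions avoid \<open>opp d\<close>, which is near \<open>b\<close>. They fail
  together only if \<open>opp c\<close> is the \<open>x\<close> of one and \<open>opp e\<close> the
  \<open>a\<close> of the other, and these two colours are antipodal.\<close>

lemma triangle_extend_weak:
  assumes "\<not> near d b" "c \<noteq> opp e"
  shows "\<exists>x a. near x b \<and> near x a \<and> \<not> near a b \<and> x \<noteq> opp c \<and> a \<noteq> opp d \<and> a \<noteq> opp e"
  by (rule triangle_extendI) (use assms in \<open>cases b; cases d; simp add: near_def; cases c; simp; cases e; simp\<close>)

text \<open>With \<open>c\<close> near \<open>b\<close>, the demands on \<open>opp c\<close> and
  \<open>c\<close> hold in both solutions, and \<open>opp d\<close> spoils at most one of
  them.\<close>

lemma triangle_extend_double:
  assumes "near c b"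
  shows "\<exists>x a. near x b \<and> near x a \<and> \<not> near a b \<and> x \<noteq> opp c \<and> a \<noteq> opp d \<and> a \<noteq> c"
  by (rule triangle_extendI) (use assms in \<open>cases b; cases c; simp add: near_def; cases d; simp\<close>)

fun odd_col :: "col \<Rightarrow> bool" where
  "odd_col C0 = False" | "odd_col C2 = False" | "odd_col C4 = False"
| "odd_col C1 = True" | "odd_col C3 = True" | "odd_col C5 = True"

text \<open>Every antipodal pair contains one even colour. So up to switching there are three
  colours, pairwise at distance 2; \<open>odd_col\<close> remembers the switch.\<close>

definition base :: "col \<Rightarrow> col" where
  "base c = flip (odd_col c) c"

lemma flip_base: "flip (odd_col c) (base c) = c"
  by (simp add: base_def)

lemma base_in: "base c \<in> {C0, C2, C4}"
  by (cases c) (auto simp: base_def flip_def)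

section \<open>Symmetries of the hexagon\<close>

definition col_aut :: "(col \<Rightarrow> col) \<Rightarrow> bool" where
  "col_aut g \<longleftrightarrow> (\<forall>c d. (g c = g d \<longleftrightarrow> c = d) \<and> (near (g c) (g d) \<longleftrightarrow> near c d)) \<and> (\<forall>c. g (opp c) = opp (g c))"

lemma col_aut_flip: "col_aut g \<Longrightarrow> g (flip s c) = flip s (g c)"
  by (simp add: col_aut_def flip_def)

lemma col_aut_allow: "col_aut g \<Longrightarrow> allow k s (g c) (g d) \<longleftrightarrow> allow k s c d"
  unfolding allow_def col_aut_flip[symmetric] by (simp add: col_aut_def del: opp_inject) (metis col_aut_def)

definition equilateral :: "col \<Rightarrow> col \<Rightarrow> bool" where
  "equilateral c d \<longleftrightarrow> \<not> near c d \<and> c \<noteq> opp d"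

lemma equilateral_commute: "equilateral c d \<longleftrightarrow> equilateral d c"
  by (cases c; cases d) (auto simp: equilateral_def near_def)

lemma equilateral_iff: "equilateral c d \<longleftrightarrow> d = rot (rot c) \<or> d = rot (rot (rot (rot c)))"
  by (cases c; cases d) (simp_all add: equilateral_def near_def)

lemma col_aut_extend:
  assumes "equilateral x y" "equilateral y z" "equilateral x z"
  shows "\<exists>g. col_aut g \<and> g C0 = x \<and> g C2 = y \<and> g C4 = z"
proof -
  let ?g = "\<lambda>c. case c of C0 \<Rightarrow> x | C2 \<Rightarrow> y | C4 \<Rightarrow> z | C3 \<Rightarrow> opp x | C5 \<Rightarrow> opp y | C1 \<Rightarrow> opp z"
  have "col_aut ?g"
    using assms unfolding col_aut_def all_col equilateral_iff
    by (cases x; cases y; simp; cases z; simp add: near_def)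
  then show ?thesis by (intro exI[of _ ?g]) simp
qed

text \<open>Every colour is near one member of each antipodal pair, so a third colour far from both
  \<open>x\<close> and \<open>y\<close> excludes that these are antipodal.\<close>

lemma equilateral_three:
  assumes "\<not> near x y" "\<not> near y z" "\<not> near x z"
  shows "equilateral x y"
  using assms by (cases x; cases y; cases z; simp add: near_def equilateral_def)

text \<open>Colours pairwise at distance 2 complete to an equilateral triple, and the images of the
  three even colours determine the automorphism because it commutes with \<open>opp\<close>.
  Antipodes are excluded separately for two colours only: for three, farness suffices.\<close>

lemma col_aut_extend_base:
  assumes I: "I \<subseteq> {C0, C2, C4}"
    and far: "\<And>i j. i \<in> I \<Longrightarrow> j \<in> I \<Longrightarrow> i \<noteq> j \<Longrightarrow> \<not> near (h i) (h j)"
    and two: "\<And>i j. I = {i, j} \<Longrightarrow> i \<noteq> j \<Longrightarrow> h i \<noteq> opp (h j)"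
  shows "\<exists>g. col_aut g \<and> (\<forall>i\<in>I. g i = h i)"
proof -
  have third: "\<exists>z. equilateral x z \<and> equilateral y z" if "equilateral x y" for x y
    using that unfolding equilateral_iff by (cases x; cases y; simp add: ex_col)
  have two': "equilateral (h i) (h j)" if "I = {i, j}" "i \<noteq> j" for i j
    using far two that by (auto simp: equilateral_def)
  have one: "\<exists>y z. equilateral x y \<and> equilateral x z \<and> equilateral y z" for x
    by (intro exI[of _ "rot (rot x)"] exI[of _ "opp (rot x)"], cases x) (simp_all add: equilateral_iff)
  consider "I = {}" | "I = {C0}" | "I = {C2}" | "I = {C4}" | "I = {C0, C2}" | "I = {C0, C4}"
    | "I = {C2, C4}" | "I = {C0, C2, C4}"
      using I[folded Pow_iff] by (simp add: Pow_insert) blast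
  then show ?thesis
  proof cases
    case 1
    then show ?thesis by (intro exI[of _ "\<lambda>c. c"]) (simp add: col_aut_def)
  next
    case 2
    obtain y z where "equilateral (h C0) y" "equilateral (h C0) z" "equilateral y z" using one by blast
    with col_aut_extend[of "h C0" y z] 2 show ?thesis by auto
  next
    case 3
    obtain y z where "equilateral (h C2) y" "equilateral (h C2) z" "equilateral y z" using one by blast
    with col_aut_extend[of y "h C2" z] 3 show ?thesis by (auto simp: equilateral_commute)
  next
    case 4
    obtain y z where "equilateral (h C4) y" "equilateral (h C4) z" "equilateral y z" using one by blast
    with col_aut_extend[of y z "h C4"] 4 show ?thesis by (auto simp: equilateral_commute)
  next
    case 5
    obtain z where "equilateral (h C0) z" "equilateral (h C2) z" using third two'[OF 5] by auto
    with col_aut_extend[of "h C0" "h C2" z] two'[OF 5] 5 show ?thesis by auto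
  next
    case 6
    obtain z where "equilateral (h C0) z" "equilateral (h C4) z" using third two'[OF 6] by auto
    with col_aut_extend[of "h C0" z "h C4"] two'[OF 6] 6 show ?thesis by (auto simp: equilateral_commute)
  next
    case 7
    obtain z where "equilateral (h C2) z" "equilateral (h C4) z" using third two'[OF 7] by auto
    with col_aut_extend[of z "h C2" "h C4"] two'[OF 7] 7 show ?thesis by (auto simp: equilateral_commute)
  next
    case 8
    then have "\<not> near (h C0) (h C2)" "\<not> near (h C2) (h C4)" "\<not> near (h C0) (h C4)"
      using far by auto
    with col_aut_extend[of "h C0" "h C2" "h C4"] equilateral_three 8 show ?thesis
      by (auto simp: near_commute)
  qed
qed

lemma allow_far: "allow True True c d \<longleftrightarrow> \<not> near c d"
  by (cases c; cases d) (simp_all add: allow_def near_def flip_def)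

lemma allow_flip_right: "allow k s c (flip t d) \<longleftrightarrow> allow k (s \<noteq> t) c d"
  by (auto simp: allow_def)

lemma near_common: "x \<noteq> opp y \<Longrightarrow> \<exists>c. near c x \<and> near c y"
  by (cases x; cases y; simp add: near_def ex_col)

lemma allow_strong: "allow True s c d \<longleftrightarrow> near c (flip s d)"
  by (simp add: allow_def)

lemma allow_weak: "allow False s c d \<longleftrightarrow> c \<noteq> opp (flip s d)"
  by (simp add: allow_def)

lemma near_opp: "near c (opp d) \<longleftrightarrow> \<not> near c d"
  by (cases c; cases d) (simp_all add: near_def)

lemma flip_eq_opp_flip: "flip s a = opp (flip t d) \<longleftrightarrow> a = opp (flip (s \<noteq> t) d)"
  by (cases s; cases t; simp add: flip_def) (metis opp_opp)+

lemma near_far_neq: "near x a \<Longrightarrow> near x b \<Longrightarrow> \<not> near a b \<Longrightarrow> x \<noteq> flip s a"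
  by (cases x; cases a; cases b; simp add: near_def flip_def)

text \<open>Exactly three colours are near \<open>w\<close>, so three values that cover them are
  these colours in some order.\<close>

lemma near_cover:
  assumes "\<And>c. near c w \<Longrightarrow> c = x \<or> c = y \<or> c = z"
  shows "near x w \<and> x \<noteq> y"
proof -
  have "near w w" "near (rot w) w" "near (opp (rot (rot w))) w"
    by (cases w; simp add: near_def)+
  then have "w = x \<or> w = y \<or> w = z" "rot w = x \<or> rot w = y \<or> rot w = z"
    "opp (rot (rot w)) = x \<or> opp (rot (rot w)) = y \<or> opp (rot (rot w)) = z"
    using assms by blast+
  moreover have "w \<noteq> rot w" "w \<noteq> opp (rot (rot w))" "rot w \<noteq> opp (rot (rot w))"
    by (cases w; simp)+
  ultimately have "x \<in> {w, rot w, opp (rot (rot w))} \<and> x \<noteq> y" by auto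
  then show ?thesis using \<open>near w w\<close> \<open>near (rot w) w\<close> \<open>near (opp (rot (rot w))) w\<close> by auto
qed

section \<open>Signed graphs with weak edges\<close>

text \<open>The flag \<open>strong\<close> distinguishes ordinary from weak edges; \<open>flipped\<close> marks positive edges
  among the strong ones. A weak edge forbids antipodal colours, or equal colours if it is flipped.
  Loops satisfy \<open>ok\<close> vacuously, hence \<open>loopless\<close>.\<close>

datatype 'v cedge = Edge (strong: bool) (flipped: bool) (ext: "'v set")

definition ok :: "('v \<Rightarrow> col) \<Rightarrow> 'v cedge \<Rightarrow> bool" where
  "ok \<phi> e \<longleftrightarrow> (\<forall>u\<in>ext e. \<forall>v\<in>ext e. u \<noteq> v \<longrightarrow> allow (strong e) (flipped e) (\<phi> u) (\<phi> v))"

definition sat :: "('v \<Rightarrow> col) \<Rightarrow> 'v cedge set \<Rightarrow> bool" where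
  "sat \<phi> E \<longleftrightarrow> (\<forall>e\<in>E. ok \<phi> e)"

definition colorable :: "'v cedge set \<Rightarrow> bool" where
  "colorable E \<longleftrightarrow> (\<exists>\<phi>. sat \<phi> E)"

definition vset :: "'v cedge set \<Rightarrow> 'v set" where
  "vset E = \<Union> (ext ` E)"

definition res :: "'v cedge set \<Rightarrow> 'v set \<Rightarrow> 'v cedge set" where
  "res E S = {e \<in> E. ext e \<subseteq> S}"

definition inc :: "'v cedge set \<Rightarrow> 'v \<Rightarrow> 'v cedge set" where
  "inc E v = {e \<in> E. v \<in> ext e}"

definition wt :: "'v cedge \<Rightarrow> int" where
  "wt e = (if strong e then 2 else 1)"

definition weight :: "'v cedge set \<Rightarrow> int" where
  "weight E = sum wt E"

definition rho :: "'v cedge set \<Rightarrow> 'v set \<Rightarrow> int" where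
  "rho E S = 3 * int (card S) - weight (res E S)"

definition loopless :: "'v cedge set \<Rightarrow> bool" where
  "loopless E \<longleftrightarrow> (\<forall>e\<in>E. card (ext e) = 2)"

definition critical :: "'v cedge set \<Rightarrow> bool" where
  "critical E \<longleftrightarrow> finite E \<and> loopless E \<and> \<not> colorable E \<and> (\<forall>e\<in>E. colorable (E - {e}))"

definition is_digon :: "'v cedge set \<Rightarrow> bool" where
  "is_digon E \<longleftrightarrow> (\<exists>u v. u \<noteq> v \<and> E = {Edge True True {u, v}, Edge True False {u, v}})"

lemma ok_pair: "u \<noteq> v \<Longrightarrow> ok \<phi> (Edge k s {u, v}) \<longleftrightarrow> allow k s (\<phi> u) (\<phi> v)"
  by (auto simp: ok_def allow_commute)

lemma ok_cong: "(\<And>v. v \<in> ext e \<Longrightarrow> \<phi> v = \<psi> v) \<Longrightarrow> ok \<phi> e \<longleftrightarrow> ok \<psi> e"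
  by (auto simp: ok_def)

lemma sat_mono: "sat \<phi> E \<Longrightarrow> F \<subseteq> E \<Longrightarrow> sat \<phi> F"
  by (auto simp: sat_def)

lemma colorable_mono: "colorable E \<Longrightarrow> F \<subseteq> E \<Longrightarrow> colorable F"
  by (meson colorable_def sat_mono)

lemma loopless_mono: "loopless E \<Longrightarrow> F \<subseteq> E \<Longrightarrow> loopless F"
  by (auto simp: loopless_def)

lemma loopless_cases:
  assumes "loopless E" "e \<in> E"
  obtains k s u v where "e = Edge k s {u, v}" "u \<noteq> v"
  using assms by (metis cedge.exhaust_sel card_2_iff loopless_def)

lemma loopless_cases_at:
  assumes "loopless E" "e \<in> E" "x \<in> ext e"
  obtains k s v where "e = Edge k s {x, v}" "x \<noteq> v"
proof -
  obtain k s u v where e: "e = Edge k s {u, v}" "u \<noteq> v"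
    using loopless_cases assms by metis
  then have "x = u \<or> x = v" using assms by auto
  with e that show ?thesis by (metis insert_commute)
qed

lemma weight_nonneg: "0 \<le> weight E"
  unfolding weight_def wt_def by (intro sum_nonneg) auto

lemma weight_mono: "finite F \<Longrightarrow> E \<subseteq> F \<Longrightarrow> weight E \<le> weight F"
  unfolding weight_def wt_def by (intro sum_mono2) auto

lemma weight_Un: "finite E \<Longrightarrow> finite F \<Longrightarrow> E \<inter> F = {} \<Longrightarrow> weight (E \<union> F) = weight E + weight F"
  unfolding weight_def by (rule sum.union_disjoint)

lemma weight_insert:
  "finite E \<Longrightarrow> weight (insert e E) = (if e \<in> E then weight E else wt e + weight E)"
  by (simp add: weight_def insert_absorb)

lemma weight_empty [simp]: "weight {} = 0"
  by (simp add: weight_def)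

lemma wt_Edge [simp]: "wt (Edge k s A) = (if k then 2 else 1)"
  by (simp add: wt_def)

lemma finite_res: "finite E \<Longrightarrow> finite (res E S)"
  by (simp add: res_def)

lemma res_vset: "res E (vset E) = E"
  by (auto simp: res_def vset_def)

lemma finite_vset: "finite E \<Longrightarrow> loopless E \<Longrightarrow> finite (vset E)"
  unfolding vset_def loopless_def by (metis (no_types, lifting) card.infinite finite_UN zero_neq_numeral)

lemma rho_vset: "rho E (vset E) = 3 * int (card (vset E)) - weight E"
  by (simp add: rho_def res_vset)

lemma vset_mono: "F \<subseteq> E \<Longrightarrow> vset F \<subseteq> vset E"
  by (auto simp: vset_def)

lemma vset_empty [simp]: "vset {} = {}"
  by (simp add: vset_def)

lemma vset_insert [simp]: "vset (insert e E) = ext e \<union> vset E"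
  by (simp add: vset_def)

lemma rho_le: "finite E \<Longrightarrow> F \<subseteq> E \<Longrightarrow> vset F \<subseteq> S \<Longrightarrow> rho E S \<le> 3 * int (card S) - weight F"
  using weight_mono[of "res E S" F] by (auto simp: rho_def res_def vset_def)

lemma rho_extend:
  assumes "finite E" "finite T" "S \<subseteq> T" "F \<subseteq> E" "vset F \<subseteq> T" "\<And>e. e \<in> F \<Longrightarrow> \<not> ext e \<subseteq> S"
  shows "rho E T \<le> rho E S + 3 * int (card (T - S)) - weight F"
proof -
  have fF: "finite F" using assms finite_subset by blast
  have "res E S \<union> F \<subseteq> res E T"
    using assms by (auto simp: res_def vset_def)
  then have "weight (res E S \<union> F) \<le> weight (res E T)"
    by (intro weight_mono finite_res assms)
  moreover have "res E S \<inter> F = {}"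
    using assms(6) by (auto simp: res_def)
  ultimately have "weight (res E S) + weight F \<le> weight (res E T)"
    using weight_Un[of "res E S" F] assms(1) fF by (simp add: finite_res)
  moreover have "card T = card S + card (T - S)"
    using assms by (metis card_Diff_subset card_mono finite_subset le_add_diff_inverse)
  ultimately show ?thesis by (simp add: rho_def)
qed

lemma minimal_uncolorable:
  assumes "finite E" "loopless E" "\<not> colorable E"
  shows "\<exists>K\<subseteq>E. critical K"
  using assms
proof (induction "card E" arbitrary: E rule: less_induct)
  case less
  show ?case
  proof (cases "\<forall>e\<in>E. colorable (E - {e})")
    case True
    with less.prems show ?thesis by (auto simp: critical_def)
  next
    case False
    then obtain e where e: "e \<in> E" "\<not> colorable (E - {e})" by auto
    have "card (E - {e}) < card E" using e less.prems by (metis card_Diff1_less)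
    from less.hyps[OF this] less.prems e(2) loopless_mono[of E "E - {e}"] show ?thesis
      by auto
  qed
qed

lemma critical_proper: "critical E \<Longrightarrow> F \<subseteq> E \<Longrightarrow> F \<noteq> E \<Longrightarrow> colorable F"
  unfolding critical_def by (metis colorable_mono subset_Diff_insert subset_antisym insert_subset subsetI Diff_empty)

lemma critical_subset_eq: "critical E \<Longrightarrow> F \<subseteq> E \<Longrightarrow> \<not> colorable F \<Longrightarrow> F = E"
  using critical_proper by blast

lemma not_colorable_digon:
  assumes "u \<noteq> v" "Edge True s {u, v} \<in> E" "Edge True (\<not> s) {u, v} \<in> E"
  shows "\<not> colorable E"
  unfolding colorable_def sat_def using assms allow_not_both[of s] ok_pair[of u v] by blast

lemma critical_digon:
  assumes "critical E" "u \<noteq> v" "Edge True s {u, v} \<in> E" "Edge True (\<not> s) {u, v} \<in> E"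
  shows "is_digon E"
proof -
  let ?F = "{Edge True True {u, v}, Edge True False {u, v}}"
  have "?F \<subseteq> E" using assms(3,4) by (cases s) auto
  moreover have "\<not> colorable ?F" by (rule not_colorable_digon[of u v True]) (use assms in auto)
  ultimately have "?F = E" using critical_subset_eq assms(1) by blast
  then show ?thesis using assms(2) unfolding is_digon_def by blast
qed

lemma sat_outside:
  assumes "sat \<phi> (res E W)" "\<And>v. v \<in> W \<Longrightarrow> \<theta> v = \<phi> v" "\<And>e. e \<in> E \<Longrightarrow> \<not> ext e \<subseteq> W \<Longrightarrow> ok \<theta> e"
  shows "sat \<theta> E"
  unfolding sat_def
proof
  fix e assume e: "e \<in> E"
  show "ok \<theta> e"
  proof (cases "ext e \<subseteq> W")
    case True
    then have "ok \<phi> e" using e assms(1) by (auto simp: sat_def res_def)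
    moreover have "ok \<theta> e = ok \<phi> e" by (rule ok_cong) (use True assms(2) in auto)
    ultimately show ?thesis by simp
  qed (use e assms(3) in auto)
qed

lemma sum_card_incident:
  assumes "finite A" "finite F"
  shows "(\<Sum>v\<in>A. card {e \<in> F. v \<in> ext e}) = (\<Sum>e\<in>F. card (ext e \<inter> A))"
proof -
  have "(\<Sum>v\<in>A. card {e \<in> F. v \<in> ext e}) = (\<Sum>v\<in>A. \<Sum>e\<in>F. if v \<in> ext e then 1 else 0)"
    by (simp add: sum.If_cases assms Int_def)
  also have "\<dots> = (\<Sum>e\<in>F. \<Sum>v\<in>A. if v \<in> ext e then 1 else 0)" by (rule sum.swap)
  also have "\<dots> = (\<Sum>e\<in>F. card (ext e \<inter> A))"
    by (simp add: sum.If_cases assms Int_commute Int_def conj_commute)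
  finally show ?thesis .
qed

section \<open>Potential of vertex sets in a minimal counterexample\<close>

text \<open>The induction compares vertices first and edges second. The second comparison matters
  for a set S whose vertices lie in different antipodal classes: its quotient keeps all vertices and
  can be smaller only through the edges inside S.\<close>

locale counterexample =
  fixes E :: "'v cedge set"
  assumes crit: "critical E" and nodigon: "\<not> is_digon E" and rho_ge: "2 \<le> rho E (vset E)"
    and IH: "\<And>K :: 'v cedge set. critical K \<Longrightarrow> \<not> is_digon K \<Longrightarrow>
      card (vset K) < card (vset E) \<or> card (vset K) = card (vset E) \<and> card K < card E \<Longrightarrow>
      rho K (vset K) \<le> 1"
begin

abbreviation "V \<equiv> vset E"

lemma finE: "finite E" and llE: "loopless E" and ncE: "\<not> colorable E"
  using crit by (auto simp: critical_def)

lemma finV: "finite V"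
  using finE llE finite_vset by blast

lemma no_strong_digon: "u \<noteq> v \<Longrightarrow> Edge True s {u, v} \<in> E \<Longrightarrow> Edge True (\<not> s) {u, v} \<notin> E"
  using critical_digon[OF crit, of u v s] nodigon by auto

text \<open>Each colour class of \<open>S\<close> modulo \<open>opp\<close> is identified to one vertex, and the classes are
  joined to a positive triangle. Two classes get a strong and a weak edge instead, which also forces distance 2;
  so any nonempty set of these vertices has potential at least 3.\<close>

lemma quotient_step:
  assumes SW: "S \<subseteq> W" and WV: "W \<subseteq> V" and Sne: "S \<noteq> {}" and phi: "sat \<phi> (res E S)"
    and noext: "\<And>\<theta> g. col_aut g \<Longrightarrow> sat \<theta> (res E W) \<Longrightarrow> (\<And>v. v \<in> S \<Longrightarrow> \<theta> v = g (\<phi> v)) \<Longrightarrow> False"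
    and small: "card ((\<lambda>v. base (\<phi> v)) ` S) < card S \<or> card ((\<lambda>v. base (\<phi> v)) ` S) < card (res E S)"
  obtains S' where "S \<subset> S'" "S' \<subseteq> W" "rho E S' \<le> rho E S - 2 \<or>
    rho E S' \<le> rho E S - 1 \<and> (\<exists>z u v s t. z \<notin> S \<and> S' = insert z S \<and> u \<in> S \<and> v \<in> S \<and> u \<noteq> v \<and>
      Edge True s {z, u} \<in> E \<and> Edge True t {z, v} \<in> E)"
proof -
  define I where "I = (\<lambda>v. base (\<phi> v)) ` S"
  define rp where "rp i = (SOME u. u \<in> S \<and> base (\<phi> u) = i)" for i
  define R where "R = rp ` I"
  define r where "r u = (if u \<in> S then rp (base (\<phi> u)) else u)" for u
  \<comment> \<open>An edge of \<open>E0\<close> has at most one end in S. If the colour of that end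
    is odd, it is the antipode of the colour of its class, so the sign of the edge is
    toggled.\<close>
  define m where "m e = Edge (strong e) (flipped e \<noteq> (\<exists>u\<in>ext e \<inter> S. odd_col (\<phi> u))) (r ` ext e)" for e
  define E0 where "E0 = res E W - res E S"
  define TS where "TS = (\<lambda>A. Edge True True (rp ` A)) ` {A. A \<subseteq> I \<and> card A = 2}"
  define TW where "TW = (if card I = 2 then {Edge False False R} else {})"
  define G where "G = m ` E0 \<union> (TS \<union> TW)"
  have finS: "finite S" and finW: "finite W"
    by (metis SW WV finV finite_subset)+
  have finI: "finite I" using finS by (simp add: I_def)
  have Ibase: "I \<subseteq> {C0, C2, C4}" using base_in by (auto simp: I_def)
  have cardI: "card I \<le> 3"
    using card_mono[OF _ Ibase] by simp
  have rp: "rp i \<in> S" "base (\<phi> (rp i)) = i" if "i \<in> I" for i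
  proof -
    have "\<exists>u. u \<in> S \<and> base (\<phi> u) = i" using that by (auto simp: I_def)
    from someI_ex[OF this] show "rp i \<in> S" "base (\<phi> (rp i)) = i" by (auto simp: rp_def)
  qed
  have inj: "inj_on rp I" by (metis inj_onI rp(2))
  have cardR: "card R = card I" using card_image[OF inj] by (simp add: R_def)
  have RS: "R \<subseteq> S" using rp by (auto simp: R_def)
  have rS: "r u \<in> R" if "u \<in> S" for u using that by (auto simp: r_def R_def I_def)
  have E0_cases: "\<exists>k s u v. e = Edge k s {u, v} \<and> u \<noteq> v \<and> u \<notin> S \<and> u \<in> W \<and> v \<in> W \<and> e \<in> E \<and> u \<noteq> r v \<and>
      m e = Edge k (s \<noteq> (v \<in> S \<and> odd_col (\<phi> v))) {u, r v}" if "e \<in> E0" for e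
  proof -
    have e: "e \<in> E" "ext e \<subseteq> W" "\<not> ext e \<subseteq> S" using that by (auto simp: E0_def res_def)
    from e(3) obtain u where u: "u \<in> ext e" "u \<notin> S" by auto
    obtain k s v where "e = Edge k s {u, v}" "u \<noteq> v"
      using loopless_cases_at[OF llE e(1) u(1)] by metis
    moreover have "u \<noteq> r v" using u RS rS \<open>u \<noteq> v\<close> unfolding r_def by auto
    moreover have "m e = Edge k (s \<noteq> (v \<in> S \<and> odd_col (\<phi> v))) {u, r v}"
      using calculation u by (auto simp: m_def r_def)
    ultimately show ?thesis using e u by auto
  qed
  have two_sub: "\<exists>i j. A = {i, j} \<and> i \<noteq> j \<and> i \<in> I \<and> j \<in> I" if "A \<subseteq> I" "card A = 2" for A
    using that by (metis card_2_iff insert_subset)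
  have rp_ne: "rp i \<noteq> rp j" if "i \<in> I" "j \<in> I" "i \<noteq> j" for i j
    using inj that by (metis inj_on_def)
  have finG: "finite G"
    using finE finI by (auto simp: G_def E0_def TS_def TW_def res_def)
  have llT: "loopless (TS \<union> TW)"
    unfolding loopless_def
  proof
    fix e assume "e \<in> TS \<union> TW"
    then consider A where "A \<subseteq> I" "card A = 2" "e = Edge True True (rp ` A)"
      | "card I = 2" "e = Edge False False R"
      by (auto simp: TS_def TW_def split: if_splits)
    then show "card (ext e) = 2"
    proof cases
      case 1
      then show ?thesis using card_image[OF inj_on_subset[OF inj]] by auto
    qed (simp add: cardR)
  qed
  have llG: "loopless G"
    unfolding loopless_def
  proof
    fix e assume "e \<in> G"
    then consider "e \<in> TS \<union> TW" | f where "f \<in> E0" "e = m f" by (auto simp: G_def)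
    then show "card (ext e) = 2"
    proof cases
      case 1
      then show ?thesis using llT by (auto simp: loopless_def)
    next
      case 2
      from E0_cases[OF 2(1)] obtain u v k s where "u \<noteq> r v" "m f = Edge k s {u, r v}" by auto
      with 2 show ?thesis by simp
    qed
  qed
  \<comment> \<open>A colouring of the quotient puts the classes at distance 2 from each other and
    so yields an automorphism \<open>g\<close>. Recolouring S by \<open>g\<close> after
    \<open>\<phi>\<close> then gives a colouring of \<open>res E W\<close> that \<open>noext\<close>
    forbids.\<close>
  have ncG: "\<not> colorable G"
  proof
    assume "colorable G"
    then obtain \<psi> where psi: "sat \<psi> G" by (auto simp: colorable_def)
    define h where "h i = \<psi> (rp i)" for i
    have far: "\<not> near (h i) (h j)" if "i \<in> I" "j \<in> I" "i \<noteq> j" for i j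
    proof -
      have "Edge True True (rp ` {i, j}) \<in> TS"
        unfolding TS_def using that by (intro imageI) auto
      then have "Edge True True (rp ` {i, j}) \<in> G"
        by (simp add: G_def)
      then have "ok \<psi> (Edge True True {rp i, rp j})" using psi by (auto simp: sat_def)
      then show ?thesis using rp_ne[OF that] by (simp add: ok_pair allow_far h_def)
    qed
    have two: "h i \<noteq> opp (h j)" if "I = {i, j}" "i \<noteq> j" for i j
    proof -
      have "Edge False False R \<in> G"
        unfolding G_def TW_def using that by auto
      then have "ok \<psi> (Edge False False {rp i, rp j})" using psi that by (auto simp: sat_def R_def)
      then show ?thesis using rp_ne[of i j] that by (simp add: ok_pair allow_not_opp h_def)
    qed
    obtain g where g: "col_aut g" "\<And>i. i \<in> I \<Longrightarrow> g i = h i"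
      using col_aut_extend_base[OF Ibase, of h] far two by metis
    define \<theta> where "\<theta> v = (if v \<in> S then g (\<phi> v) else \<psi> v)" for v
    have "sat \<theta> (res E W)"
      unfolding sat_def
    proof
      fix e assume e: "e \<in> res E W"
      show "ok \<theta> e"
      proof (cases "e \<in> res E S")
        case True
        then have "ok \<phi> e" "ext e \<subseteq> S" using phi by (auto simp: sat_def res_def)
        then show ?thesis using col_aut_allow[OF g(1)] by (auto simp: ok_def \<theta>_def)
      next
        case False
        then have e0: "e \<in> E0" using e by (simp add: E0_def)
        from E0_cases[OF this] obtain k s u v where
          uv: "e = Edge k s {u, v}" "u \<noteq> v" "u \<notin> S" "u \<noteq> r v"
            "m e = Edge k (s \<noteq> (v \<in> S \<and> odd_col (\<phi> v))) {u, r v}" by auto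
        have "ok \<psi> (m e)" using psi e0 by (auto simp: sat_def G_def)
        then have 1: "allow k (s \<noteq> (v \<in> S \<and> odd_col (\<phi> v))) (\<psi> u) (\<psi> (r v))"
          using uv by (simp add: ok_pair)
        have "allow k s (\<theta> u) (\<theta> v)"
        proof (cases "v \<in> S")
          case True
          then have "base (\<phi> v) \<in> I" by (auto simp: I_def)
          then have "g (base (\<phi> v)) = \<psi> (r v)" using g(2) True by (simp add: h_def r_def)
          then have "g (\<phi> v) = flip (odd_col (\<phi> v)) (\<psi> (r v))"
            by (metis col_aut_flip[OF g(1)] flip_base)
          then show ?thesis using True 1 uv by (simp add: \<theta>_def allow_flip_right)
        next
          case False
          then show ?thesis using 1 uv by (simp add: \<theta>_def r_def)
        qed
        then show ?thesis using uv by (simp add: ok_pair)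
      qed
    qed
    then show False using noext[OF g(1), of \<theta>] by (simp add: \<theta>_def)
  qed
  obtain K where KG: "K \<subseteq> G" and Kcrit: "critical K"
    using minimal_uncolorable[OF finG llG ncG] by auto
  have finK: "finite K" and llK: "loopless K" and ncK: "\<not> colorable K"
    using Kcrit by (auto simp: critical_def)
  have extT: "ext e \<subseteq> R" if "e \<in> TS \<union> TW" for e
    using that unfolding TS_def TW_def R_def by (cases "card I = 2") (auto intro!: imageI)
  have vG: "vset G \<subseteq> (W - S) \<union> R"
  proof
    fix x assume "x \<in> vset G"
    then obtain e where e: "e \<in> G" "x \<in> ext e" by (auto simp: vset_def)
    show "x \<in> (W - S) \<union> R"
    proof (cases "e \<in> TS \<union> TW")
      case True then show ?thesis using extT e by blast
    next
      case False
      then obtain f where f: "f \<in> E0" "e = m f" using e by (auto simp: G_def)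
      from E0_cases[OF f(1)] obtain k s u v where
        "u \<notin> S" "u \<in> W" "v \<in> W" "m f = Edge k s {u, r v}" by auto
      then have "x = u \<or> x = r v" using e f by auto
      moreover have "r v = v" if "v \<notin> S" using that by (simp add: r_def)
      ultimately show ?thesis using \<open>u \<notin> S\<close> \<open>u \<in> W\<close> \<open>v \<in> W\<close> rS[of v] by (cases "v \<in> S") auto
    qed
  qed
  define U where "U = vset K - S"
  define X where "X = vset K \<inter> S"
  have UW: "U \<subseteq> W - S" and XR: "X \<subseteq> R"
    using vset_mono[OF KG] vG RS by (auto simp: U_def X_def)
  have fin: "finite U" "finite X" "finite (vset K)"
    using finite_vset[OF finK llK] by (auto simp: U_def X_def)
  have cardK: "card (vset K) = card U + card X"
  proof -
    have "vset K = U \<union> X" "U \<inter> X = {}" by (auto simp: U_def X_def)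
    then show ?thesis using card_Un_disjoint fin by metis
  qed
  have cardV: "card (W - S) + card S \<le> card V"
    using card_mono[OF finV WV] card_Diff_subset[OF finS SW] card_mono[OF finW SW] by simp
  have vK: "card (vset K) \<le> card (W - S) + card I"
    using cardK card_mono[OF _ UW] card_mono[OF _ XR] finW finI cardR by (simp add: R_def)
  have pairs: "card {A. A \<subseteq> I \<and> card A = 2} = card I choose 2"
    using n_subsets[OF finI] by simp
  \<comment> \<open>At most 0, 0, 2, 3 gluing edges are added for 0, 1, 2, 3 classes. So if no
    vertex is lost, the edge count drops as soon as S carries more edges than there are
    classes.\<close>
  have cardT: "card (TS \<union> TW) \<le> card I"
  proof -
    have "card (TS \<union> TW) \<le> card TS + card TW" by (rule card_Un_le)
    also have "card TS \<le> card I choose 2"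
      unfolding TS_def pairs[symmetric] by (rule card_image_le) (use finI in auto)
    finally have *: "card (TS \<union> TW) \<le> (card I choose 2) + card TW" by simp
    consider "card I = 0" | "card I = 1" | "card I = 2" | "card I = 3" using cardI by linarith
    then show ?thesis using * by cases (auto simp: TW_def numeral_3_eq_3 numeral_2_eq_2)
  qed
  have cardKE: "card K \<le> card E0 + card I"
  proof -
    have "finite E0" using finE by (simp add: E0_def res_def)
    then have "card G \<le> card E0 + card (TS \<union> TW)"
      unfolding G_def by (meson add_mono_thms_linordered_semiring(3) card_Un_le card_image_le le_trans)
    then show ?thesis using card_mono[OF finG KG] cardT by linarith
  qed
  have cardE0: "card E0 + card (res E S) \<le> card E"
  proof -
    have "card E0 + card (res E S) = card (E0 \<union> res E S)"
      using finE by (intro card_Un_disjoint[symmetric]) (auto simp: E0_def res_def)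
    also have "\<dots> \<le> card E" by (rule card_mono[OF finE]) (auto simp: E0_def res_def)
    finally show ?thesis .
  qed
  have small': "card I < card S \<or> card I < card (res E S)" using small by (simp add: I_def)
  have IleS: "card I \<le> card S" unfolding I_def by (rule card_image_le[OF finS])
  have measure: "card (vset K) < card V \<or> card (vset K) = card V \<and> card K < card E"
    using small' IleS vK cardV cardKE cardE0 by linarith
  define M where "M = K - (TS \<union> TW)"
  define N where "N = K \<inter> (TS \<union> TW)"
  define P where "P = {e \<in> E0. m e \<in> M}"
  have MP: "M = m ` P" using KG by (auto simp: M_def P_def G_def)
  have finP: "finite P" using finE by (auto simp: P_def E0_def res_def)
  \<comment> \<open>Different edges may coincide in the quotient; taking all preimages can only
    increase the weight.\<close>
  have wMP: "weight M \<le> weight P"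
  proof -
    have "weight M \<le> sum (wt \<circ> m) P" unfolding MP weight_def
      by (rule sum_image_le[OF finP]) (simp add: wt_def)
    also have "\<dots> = weight P" unfolding weight_def by (rule sum.cong) (auto simp: wt_def m_def)
    finally show ?thesis .
  qed
  have wK: "weight K = weight M + weight N"
    using weight_Un[of M N] finK by (simp add: M_def N_def Un_Diff_Int Int_Diff Diff_disjoint disjoint_iff)
  \<comment> \<open>The even colours satisfy all gluing edges, so K must use an edge with an end
    outside S.\<close>
  have Mne: "M \<noteq> {}"
  proof
    assume "M = {}"
    then have KT: "K \<subseteq> TS \<union> TW" by (auto simp: M_def)
    have far: "\<not> near i j \<and> i \<noteq> opp j" if "i \<in> I" "j \<in> I" "i \<noteq> j" for i j
    proof -
      have "i \<in> {C0, C2, C4}" "j \<in> {C0, C2, C4}" using that Ibase by auto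
      then show ?thesis using that(3) by (auto simp: near_def)
    qed
    have "sat (\<lambda>v. base (\<phi> v)) (TS \<union> TW)"
      unfolding sat_def
    proof
      fix e assume "e \<in> TS \<union> TW"
      then consider A where "A \<subseteq> I" "card A = 2" "e = Edge True True (rp ` A)"
        | "card I = 2" "e = Edge False False (rp ` I)"
        by (auto simp: TS_def TW_def R_def split: if_splits)
      then show "ok (\<lambda>v. base (\<phi> v)) e"
      proof cases
        case 1
        from two_sub[OF 1(1,2)] obtain i j where ij: "A = {i, j}" "i \<noteq> j" "i \<in> I" "j \<in> I" by auto
        then show ?thesis using 1 rp_ne[of i j] rp far by (simp add: ok_pair allow_far)
      next
        case 2
        from two_sub[OF order_refl 2(1)] obtain i j where ij: "I = {i, j}" "i \<noteq> j" "i \<in> I" "j \<in> I" by auto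
        then have "e = Edge False False {rp i, rp j}" using 2 by simp
        then show ?thesis using ij rp_ne[of i j] rp far by (simp add: ok_pair allow_not_opp)
      qed
    qed
    then show False using KT ncK colorable_def sat_mono by metis
  qed
  have Une: "U \<noteq> {}"
  proof -
    from Mne obtain f where f: "f \<in> P" using MP by auto
    then have "f \<in> E0" "m f \<in> K" by (auto simp: P_def M_def)
    from E0_cases[OF this(1)] obtain k s u A where "u \<notin> S" "m f = Edge k s (insert u A)" by auto
    with \<open>m f \<in> K\<close> have "u \<in> U" by (force simp: U_def vset_def)
    then show ?thesis by auto
  qed
  \<comment> \<open>If K missed S, it would consist of edges of E and hence be E by criticality, but
    E has vertices in S.\<close>
  have Xne: "X \<noteq> {}"
  proof
    assume X0: "X = {}"
    have "K \<subseteq> E"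
    proof
      fix e assume e: "e \<in> K"
      then have disj: "ext e \<inter> S = {}" using X0 by (auto simp: X_def vset_def)
      have "ext e \<noteq> {}" using llK e by (auto simp: loopless_def)
      then have "e \<notin> TS \<union> TW" using disj extT[of e] RS by auto
      then obtain f where f: "f \<in> E0" "e = m f" using KG e by (auto simp: G_def)
      from E0_cases[OF f(1)] obtain k s u v where uv: "f = Edge k s {u, v}" "f \<in> E"
        "m f = Edge k (s \<noteq> (v \<in> S \<and> odd_col (\<phi> v))) {u, r v}" by auto
      then have "v \<notin> S" using disj f rS[of v] RS by auto
      then show "e \<in> E" using uv f by (simp add: r_def)
    qed
    then have "K = E" using critical_subset_eq[OF crit _ ncK] by blast
    then show False using X0 SW WV Sne by (auto simp: X_def)
  qed
  have wN: "weight N + 3 \<le> 3 * int (card X)"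
  proof -
    have extN: "ext e \<subseteq> X" if "e \<in> N" for e
      using that extT[of e] RS by (auto simp: N_def X_def vset_def)
    define NS where "NS = (\<lambda>A. Edge True True A) ` {A. A \<subseteq> X \<and> card A = 2}"
    define NW where "NW = (if card X = 2 then {Edge False False R} else {})"
    have sub: "N \<subseteq> NS \<union> NW"
    proof
      fix e assume e: "e \<in> N"
      then have c2: "card (ext e) = 2" using llK by (auto simp: N_def loopless_def)
      have "e \<in> TS \<or> e \<in> TW" using e by (auto simp: N_def)
      then show "e \<in> NS \<union> NW"
      proof
        assume "e \<in> TS"
        then have "e = Edge True True (ext e)" by (auto simp: TS_def)
        then show ?thesis using extN[OF e] c2 unfolding NS_def by blast
      next
        assume "e \<in> TW"
        then have "card I = 2" "e = Edge False False R" by (auto simp: TW_def split: if_splits)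
        then have "X = R" using extN[OF e] XR by auto
        then show ?thesis using \<open>card I = 2\<close> \<open>e = _\<close> cardR by (simp add: NW_def)
      qed
    qed
    have finNS: "finite NS" "finite NW" using fin(2) by (auto simp: NS_def NW_def)
    have "weight NS \<le> 2 * int (card NS)"
      unfolding weight_def NS_def by (rule order_trans[OF sum_bounded_above[where K = 2]]) auto
    also have "card NS \<le> card X choose 2"
      unfolding NS_def n_subsets[OF fin(2), symmetric] by (rule card_image_le) (use fin in auto)
    finally have w1: "weight NS \<le> 2 * int (card X choose 2)" by simp
    have w2: "weight NW \<le> (if card X = 2 then 1 else 0)"
      by (simp add: NW_def weight_insert)
    have "weight N \<le> weight (NS \<union> NW)" using weight_mono[OF _ sub] finNS by simp
    also have "\<dots> \<le> weight NS + weight NW"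
      unfolding weight_def using finNS sum_Un[of NS NW wt] weight_nonneg[of "NS \<inter> NW"] by (simp add: weight_def)
    finally have "weight N \<le> 2 * int (card X choose 2) + (if card X = 2 then 1 else 0)"
      using w1 w2 by linarith
    moreover have "card X \<le> 3" using card_mono[OF _ XR] finI cardR cardI by (simp add: R_def)
    moreover have "card X \<noteq> 0" using Xne fin by simp
    ultimately show ?thesis
    proof -
      assume a: "weight N \<le> 2 * int (card X choose 2) + (if card X = 2 then 1 else 0)"
        and b: "card X \<le> 3" "card X \<noteq> 0"
      consider "card X = 1" | "card X = 2" | "card X = 3" using b by linarith
      then show ?thesis using a by cases (auto simp: numeral_3_eq_3 numeral_2_eq_2)
    qed
  qed
  define S' where "S' = S \<union> U"
  have S'S: "S' - S = U" using UW by (auto simp: S'_def)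
  have rhoS': "rho E S' \<le> rho E S + 3 * int (card U) - weight P"
  proof -
    have "rho E S' \<le> rho E S + 3 * int (card (S' - S)) - weight P"
    proof (rule rho_extend[OF finE])
      show "finite S'" "S \<subseteq> S'" using finS fin by (auto simp: S'_def)
      show "P \<subseteq> E" by (auto simp: P_def E0_def res_def)
      show "\<not> ext e \<subseteq> S" if "e \<in> P" for e using that by (auto simp: P_def E0_def res_def)
      show "vset P \<subseteq> S'"
      proof
        fix x assume "x \<in> vset P"
        then obtain e where e: "e \<in> P" "x \<in> ext e" by (auto simp: vset_def)
        show "x \<in> S'"
        proof (cases "x \<in> S")
          case False
          then have "x \<in> ext (m e)" using e by (force simp: m_def r_def)
          moreover have "m e \<in> K" using e by (auto simp: P_def M_def)
          ultimately show ?thesis using False by (auto simp: S'_def U_def vset_def)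
        qed (simp add: S'_def)
      qed
    qed
    then show ?thesis by (simp only: S'S)
  qed
  \<comment> \<open>Pulling K back replaces the glued vertices X, which carry potential at least 3,
    by the whole set S.\<close>
  have rhoK: "rho E S' \<le> rho E S + rho K (vset K) - 3"
    using rhoS' wMP wK wN cardK by (simp add: rho_vset)
  have sub: "S \<subset> S'" "S' \<subseteq> W" using Une UW SW by (auto simp: S'_def U_def)
  show ?thesis
  proof (cases "is_digon K")
    case False
    then have "rho K (vset K) \<le> 1" using IH Kcrit measure by blast
    then show ?thesis using rhoK by (intro that[OF sub]) simp
  next
    case True
    then obtain p q where pq: "p \<noteq> q" "K = {Edge True True {p, q}, Edge True False {p, q}}"
      by (auto simp: is_digon_def)
    have vK: "vset K = {p, q}" by (auto simp: pq vset_def)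
    have "weight K = 4" by (simp add: pq weight_insert)
    then have "rho K (vset K) = 2" using pq(1) unfolding rho_vset by (simp add: vK)
    then have le: "rho E S' \<le> rho E S - 1" using rhoK by simp
    obtain z p' where z: "z \<notin> S" "p' \<in> S" "{p, q} = {z, p'}"
    proof (cases "p \<in> S")
      case True
      then have "q \<notin> S" using Une vK by (auto simp: U_def)
      then show ?thesis using True that[of q p] by auto
    next
      case False
      then have "q \<in> S" using Xne vK by (auto simp: X_def)
      then show ?thesis using False that[of p q] by auto
    qed
    have "z \<noteq> p'" using z by auto
    have S'z: "S' = insert z S" using z vK by (auto simp: S'_def U_def)
    \<comment> \<open>Both edges of the digon come from strong edges between z and S. If these had
      the same end in S, their signs would differ and E would contain a strong digon.\<close>
    have pre: "\<exists>u t. u \<in> S \<and> r u = p' \<and> Edge True t {z, u} \<in> E \<and> s = (t \<noteq> odd_col (\<phi> u))" for s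
    proof -
      have "Edge True s {p, q} \<in> K" using pq by (cases s) auto
      then have inK: "Edge True s {z, p'} \<in> K" using z(3) by simp
      have "Edge True s {z, p'} \<notin> TS \<union> TW" using extT[of "Edge True s {z, p'}"] z RS by auto
      then obtain f where f: "f \<in> E0" "Edge True s {z, p'} = m f" using KG inK by (auto simp: G_def)
      from E0_cases[OF f(1)] obtain k s' u v where uv: "f = Edge k s' {u, v}" "u \<notin> S" "f \<in> E"
        "m f = Edge k (s' \<noteq> (v \<in> S \<and> odd_col (\<phi> v))) {u, r v}" by auto
      then have 1: "k = True" "s = (s' \<noteq> (v \<in> S \<and> odd_col (\<phi> v)))" "{z, p'} = {u, r v}" using f by auto
      then have 2: "u = z" "r v = p'" using z uv \<open>z \<noteq> p'\<close> by (auto simp: doubleton_eq_iff)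
      then have 3: "v \<in> S" using z(2) by (auto simp: r_def split: if_splits)
      with 1 2 uv show ?thesis by (intro exI[of _ v] exI[of _ s']) auto
    qed
    from pre[of True] obtain u t where u: "u \<in> S" "Edge True t {z, u} \<in> E" "t \<noteq> odd_col (\<phi> u)" by auto
    from pre[of False] obtain v t' where v: "v \<in> S" "Edge True t' {z, v} \<in> E" "t' = odd_col (\<phi> v)" by auto
    have "u \<noteq> v"
    proof
      assume "u = v"
      then have "t' = (\<not> t)" using u v by auto
      then show False using no_strong_digon[of z u t] u v \<open>u = v\<close> z by auto
    qed
    then have "\<exists>z u v s t. z \<notin> S \<and> S' = insert z S \<and> u \<in> S \<and> v \<in> S \<and> u \<noteq> v \<and>
      Edge True s {z, u} \<in> E \<and> Edge True t {z, v} \<in> E"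
      using S'z z(1) u(1,2) v(1,2) by metis
    then show ?thesis using le by (intro that[OF sub] disjI2 conjI)
  qed
qed

text \<open>A single vertex, a strong edge with a parallel weak one, or a strong triangle can have
  potential 3 although its quotient need not be smaller. Such sets must be allowed as exceptions
  when sets of potential 3 are excluded.\<close>

definition rigid :: "'v set \<Rightarrow> bool" where
  "rigid S \<longleftrightarrow> card S \<le> 3 \<and> (\<forall>u\<in>S. \<forall>v\<in>S. u \<noteq> v \<longrightarrow> (\<exists>s. Edge True s {u, v} \<in> E))"

definition sdeg :: "'v \<Rightarrow> nat" where
  "sdeg v = card {e \<in> inc E v. strong e}"

definition wdeg :: "'v \<Rightarrow> nat" where
  "wdeg v = card {e \<in> inc E v. \<not> strong e}"

lemma finite_inc: "finite (inc E v)"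
  using finE by (simp add: inc_def)

lemma weight_inc: "weight (inc E v) = 2 * int (sdeg v) + int (wdeg v)"
proof -
  have "weight (inc E v) = weight {e \<in> inc E v. strong e} + weight {e \<in> inc E v. \<not> strong e}"
    by (subst weight_Un[symmetric]) (auto simp: finite_inc intro: arg_cong[of _ _ weight])
  then show ?thesis by (simp add: weight_def wt_def sdeg_def wdeg_def)
qed

lemma edge_at:
  assumes "e \<in> E" "v \<in> ext e"
  obtains k s u where "e = Edge k s {v, u}" "v \<noteq> u" "u \<in> V" "v \<in> V"
proof -
  obtain k s u where "e = Edge k s {v, u}" "v \<noteq> u"
    using loopless_cases_at[OF llE assms] by metis
  moreover have "u \<in> V" "v \<in> V" using calculation assms by (force simp: vset_def)+
  ultimately show ?thesis using that by blast
qed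

lemma edge_ends: "Edge k s {u, v} \<in> E \<Longrightarrow> u \<noteq> v \<and> u \<in> V \<and> v \<in> V"
  using llE by (force simp: loopless_def vset_def card_insert_if split: if_splits)

lemma strong_edge_unique: "Edge True s {u, v} \<in> E \<Longrightarrow> Edge True t {u, v} \<in> E \<Longrightarrow> s = t"
  using no_strong_digon[of u v s] edge_ends[of True s u v] by (cases s; cases t) auto

lemma strong_deg_cases:
  assumes "sdeg v = 2"
  obtains a s b t where "{e \<in> inc E v. strong e} = {Edge True s {v, a}, Edge True t {v, b}}"
    "a \<noteq> b" "a \<noteq> v" "b \<noteq> v" "Edge True s {v, a} \<in> E" "Edge True t {v, b} \<in> E"
proof -
  from assms obtain e f where ef: "{e \<in> inc E v. strong e} = {e, f}" "e \<noteq> f"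
    unfolding sdeg_def card_2_iff by auto
  then have e: "e \<in> E" "v \<in> ext e" "strong e" and f: "f \<in> E" "v \<in> ext f" "strong f"
    by (auto simp: inc_def)
  obtain k s a where a: "e = Edge k s {v, a}" "v \<noteq> a" using edge_at[OF e(1,2)] by metis
  obtain k' t b where b: "f = Edge k' t {v, b}" "v \<noteq> b" using edge_at[OF f(1,2)] by metis
  have k: "k" "k'" using a b e f by auto
  have "a \<noteq> b"
    using strong_edge_unique[of s v a t] a b e f ef(2) k by auto
  then show ?thesis using that[of s a t b] a b k ef(1) e f by auto
qed

lemma weak_deg1_cases:
  assumes "wdeg v = 1"
  obtains c s where "{e \<in> inc E v. \<not> strong e} = {Edge False s {v, c}}" "c \<noteq> v" "Edge False s {v, c} \<in> E"
proof -
  from assms obtain e where e: "{e \<in> inc E v. \<not> strong e} = {e}"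
    unfolding wdeg_def by (metis card_1_singletonE)
  then have e': "e \<in> E" "v \<in> ext e" "\<not> strong e" by (auto simp: inc_def)
  obtain k s c where "e = Edge k s {v, c}" "v \<noteq> c" using edge_at[OF e'(1,2)] by metis
  then show ?thesis using that[of s c] e e' by auto
qed

lemma inc_split: "inc E v = {e \<in> inc E v. strong e} \<union> {e \<in> inc E v. \<not> strong e}"
  by auto

lemma res_proper_colorable:
  assumes "S \<subset> V"
  shows "\<exists>\<phi>. sat \<phi> (res E S)"
proof -
  from assms obtain v e where "v \<notin> S" "e \<in> E" "v \<in> ext e" by (auto simp: vset_def)
  then have "res E S \<noteq> E" by (auto simp: res_def)
  then show ?thesis using critical_proper[OF crit, of "res E S"] by (auto simp: res_def colorable_def)
qed

lemma no_extension:
  assumes "sat \<phi> (res E (V - D))" "\<And>v. v \<notin> D \<Longrightarrow> \<theta> v = \<phi> v"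
    "\<And>e v. e \<in> inc E v \<Longrightarrow> v \<in> D \<Longrightarrow> ok \<theta> e"
  shows False
proof -
  have "sat \<theta> E"
  proof (rule sat_outside[OF assms(1)])
    show "ok \<theta> e" if "e \<in> E" "\<not> ext e \<subseteq> V - D" for e
    proof -
      from that obtain v where "v \<in> ext e" "v \<in> D" by (auto simp: vset_def)
      then show ?thesis using assms(3)[of e v] that by (auto simp: inc_def)
    qed
  qed (use assms(2) in auto)
  then show False using ncE by (auto simp: colorable_def)
qed

text \<open>A strong edge forbids three of the six colours and a weak edge one. If not all six are
  forbidden, a colouring of the other vertices extends.\<close>

lemma degree_bound:
  assumes v: "v \<in> V"
  shows "6 \<le> 3 * sdeg v + wdeg v"
proof (rule ccontr)
  assume lt: "\<not> ?thesis"
  obtain \<phi> where phi: "sat \<phi> (res E (V - {v}))"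
    using res_proper_colorable[of "V - {v}"] v by auto
  define F where "F e = {c. \<not> ok (\<phi>(v := c)) e}" for e
  have cF: "card (F e) = (if strong e then 3 else 1)" if "e \<in> inc E v" for e
  proof -
    have "e \<in> E" "v \<in> ext e" using that by (auto simp: inc_def)
    then obtain k s u where e: "e = Edge k s {v, u}" "v \<noteq> u" using edge_at by metis
    have "F e = {c. \<not> allow k s c (\<phi> u)}" using e by (auto simp: F_def ok_pair)
    then show ?thesis using card_forbidden e by simp
  qed
  have "card (\<Union> (F ` inc E v)) \<le> (\<Sum>e\<in>inc E v. card (F e))"
    by (rule card_UN_le[OF finite_inc])
  also have "\<dots> = (\<Sum>e\<in>inc E v. if strong e then 3 else 1)"
    by (rule sum.cong) (use cF in auto)
  also have "\<dots> = 3 * sdeg v + wdeg v"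
    by (simp add: sum.If_cases[OF finite_inc] sdeg_def wdeg_def Int_def conj_commute)
  finally have "card (\<Union> (F ` inc E v)) < 6" using lt by simp
  moreover have "card (UNIV :: col set) = 6" by (simp add: UNIV_col)
  ultimately have "\<Union> (F ` inc E v) \<noteq> UNIV" by auto
  then obtain c where c: "\<And>e. e \<in> inc E v \<Longrightarrow> ok (\<phi>(v := c)) e" by (auto simp: F_def)
  show False
    by (rule no_extension[OF phi, of "\<phi>(v := c)"]) (use c in auto)
qed

text \<open>The graph with D deleted and A added is not colourable, so it contains a critical K with
  fewer vertices than E. If K has potential at most 1, dropping its added edges raises the potential
  by their weight. Otherwise K is a digon containing an added strong edge.\<close>

lemma gadget:
  assumes D: "D \<subseteq> V" "D \<noteq> {}" and A: "finite A" "loopless A" "vset A \<subseteq> V - D"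
    and noext: "\<And>\<phi>. sat \<phi> (res E (V - D)) \<Longrightarrow> sat \<phi> A \<Longrightarrow> False"
  obtains A' S where "A' \<subseteq> A" "A' \<noteq> {}" "A' \<inter> E = {}" "vset A' \<subseteq> S" "S \<subseteq> V - D" "S \<noteq> {}"
    "rho E S \<le> 1 + weight A' \<or>
     (\<exists>s u v. u \<noteq> v \<and> Edge True s {u, v} \<in> A' \<and> Edge True (\<not> s) {u, v} \<in> E \<union> A)"
proof -
  define G where "G = res E (V - D) \<union> A"
  have "finite G" using A finE by (simp add: G_def res_def)
  moreover have "loopless G" using A llE by (auto simp: G_def res_def loopless_def)
  moreover have "\<not> colorable G"
    using noext by (auto simp: colorable_def G_def sat_def)
  ultimately obtain K where K: "K \<subseteq> G" "critical K" using minimal_uncolorable by blast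
  have finK: "finite K" and llK: "loopless K" and ncK: "\<not> colorable K"
    using K by (auto simp: critical_def)
  have vK: "vset K \<subseteq> V - D"
    using vset_mono[OF K(1)] A(3) by (auto simp: G_def res_def vset_def)
  then have "card (vset K) < card V"
    using D finV by (intro psubset_card_mono) auto
  have ne: "K - E \<noteq> {}"
  proof
    assume "K - E = {}"
    then have "K = E" using critical_subset_eq[OF crit _ ncK] by blast
    then show False using vK D by auto
  qed
  have Sne: "vset K \<noteq> {}"
  proof -
    from ne obtain e where "e \<in> K" by auto
    then have "ext e \<noteq> {}" "ext e \<subseteq> vset K" using llK by (auto simp: loopless_def vset_def)
    then show ?thesis by auto
  qed
  have last: "rho E (vset K) \<le> 1 + weight (K - E) \<or>
     (\<exists>s u v. u \<noteq> v \<and> Edge True s {u, v} \<in> K - E \<and> Edge True (\<not> s) {u, v} \<in> E \<union> A)"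
  proof (cases "is_digon K")
    case False
    then have "rho K (vset K) \<le> 1" using IH K \<open>card (vset K) < card V\<close> by blast
    moreover have "rho E (vset K) \<le> 3 * int (card (vset K)) - weight (K \<inter> E)"
      by (rule rho_le[OF finE]) (auto simp: vset_def)
    moreover have "weight K = weight (K \<inter> E) + weight (K - E)"
      using weight_Un[of "K \<inter> E" "K - E"] finK by (metis Int_Diff_Un Int_Diff_disjoint finite_Diff finite_Int)
    ultimately show ?thesis by (simp add: rho_vset)
  next
    case True
    then obtain u v where uv: "u \<noteq> v" "K = {Edge True True {u, v}, Edge True False {u, v}}"
      by (auto simp: is_digon_def)
    then obtain s where "Edge True s {u, v} \<in> K - E" using ne by auto
    moreover have "Edge True (\<not> s) {u, v} \<in> E \<union> A"
      using K(1) uv by (cases s) (auto simp: G_def res_def)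
    ultimately show ?thesis using uv(1) by blast
  qed
  show ?thesis
  proof (rule that[OF _ ne _ _ vK Sne last])
    show "K - E \<subseteq> A" using K(1) by (auto simp: G_def res_def)
  qed (auto simp: vset_def)
qed

section \<open>Potential of proper vertex sets\<close>

lemma small_sets_dense:
  assumes S: "finite S" "S \<noteq> {}" "card S \<le> 3" and r: "rho E S \<le> 3" "rho E S \<le> 2 \<or> \<not> rigid S"
  shows "card S < card (res E S)"
proof -
  define Q where "Q = {e \<in> res E S. strong e}"
  have finQ: "finite Q" "finite (res E S)" using finE by (auto simp: Q_def res_def)
  have w: "weight (res E S) = int (card (res E S)) + int (card Q)"
  proof -
    have "weight (res E S) = (\<Sum>e\<in>res E S. 1 + (if strong e then 1 else 0))"
      unfolding weight_def by (rule sum.cong) (auto simp: wt_def)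
    also have "\<dots> = int (card (res E S)) + int (card Q)"
      using finQ by (simp add: sum.distrib sum.If_cases Q_def Int_def)
    finally show ?thesis .
  qed
  have extQ: "ext ` Q \<subseteq> {A. A \<subseteq> S \<and> card A = 2}"
    using llE by (auto simp: Q_def res_def loopless_def)
  have injQ: "inj_on ext Q"
  proof (rule inj_onI)
    fix e f assume ef: "e \<in> Q" "f \<in> Q" "ext e = ext f"
    then have "e \<in> E" "f \<in> E" "strong e" "strong f" by (auto simp: Q_def res_def)
    obtain k s u v where e: "e = Edge k s {u, v}"
      by (rule loopless_cases[OF llE \<open>e \<in> E\<close>])
    then have e': "Edge True s {u, v} \<in> E" and f': "f = Edge True (flipped f) {u, v}"
      using ef(3) \<open>e \<in> E\<close> \<open>strong e\<close> \<open>strong f\<close> by (auto intro: cedge.expand)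
    have "Edge True (flipped f) {u, v} \<in> E" using f' \<open>f \<in> E\<close> by simp
    then have "s = flipped f" using strong_edge_unique e' by blast
    then show "e = f" using e f' \<open>strong e\<close> by simp
  qed
  have pairs: "card {A. A \<subseteq> S \<and> card A = 2} = card S choose 2" "finite {A. A \<subseteq> S \<and> card A = 2}"
    using n_subsets[OF S(1)] S(1) by auto
  have q1: "card Q \<le> card S choose 2"
    using card_mono[OF pairs(2) extQ] card_image[OF injQ] pairs(1) by simp
  have q2: "card Q < card S choose 2" if "\<not> rigid S"
  proof -
    from that S(3) obtain u v where uv: "u \<in> S" "v \<in> S" "u \<noteq> v" "\<And>s. Edge True s {u, v} \<notin> E"
      by (auto simp: rigid_def)
    have "{u, v} \<notin> ext ` Q"
    proof
      assume "{u, v} \<in> ext ` Q"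
      then obtain e where "e \<in> E" "strong e" "ext e = {u, v}" by (auto simp: Q_def res_def)
      then show False using uv(4) by (metis cedge.collapse)
    qed
    moreover have "{u, v} \<in> {A. A \<subseteq> S \<and> card A = 2}" using uv by simp
    ultimately have "ext ` Q \<subset> {A. A \<subseteq> S \<and> card A = 2}" using extQ by blast
    then show ?thesis using psubset_card_mono[OF pairs(2)] card_image[OF injQ] pairs(1) by metis
  qed
  have one: "res E S = {}" "rigid S" if "card S = 1"
    using that llE by (auto simp: rigid_def card_1_singleton_iff res_def loopless_def
        dest!: card_mono[rotated])
  \<comment> \<open>With n vertices, m edges and q strong edges the potential is 3n - m - q. As q is
    at most the number of pairs, and strictly less if S is not rigid, m > n follows for n = 2 and n
    = 3. A single vertex is rigid and has potential 3.\<close>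
  have "card S \<noteq> 0" using S by simp
  then consider "card S = 1" | "card S = 2" | "card S = 3" using S(3) by linarith
  then show ?thesis
  proof cases
    case 1
    then show ?thesis using one r by (simp add: rho_def)
  next
    case 2
    have "card S choose 2 = 1" using 2 by simp
    then show ?thesis using r q1 q2 w 2 unfolding rho_def by linarith
  next
    case 3
    have "card S choose 2 = 3" using 3 by (simp add: numeral_3_eq_3 numeral_2_eq_2)
    then show ?thesis using r q1 q2 w 3 unfolding rho_def by linarith
  qed
qed

text \<open>V itself has no colouring, so any colouring of S may be collapsed. There are at most
  three classes: the quotient loses vertices if S is larger than that, and edges by
  \<open>small_sets_dense\<close> otherwise.\<close>

lemma gap_step:
  assumes S: "S \<noteq> {}" "S \<subset> V" and r: "rho E S \<le> 3" "rho E S \<le> 2 \<or> \<not> rigid S"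
  obtains S' where "S \<subset> S'" "S' \<subseteq> V" "rho E S' \<le> rho E S - 2 \<or>
    rho E S' \<le> rho E S - 1 \<and> (\<exists>z u v s t. z \<notin> S \<and> S' = insert z S \<and> u \<in> S \<and> v \<in> S \<and> u \<noteq> v \<and>
      Edge True s {z, u} \<in> E \<and> Edge True t {z, v} \<in> E)"
proof -
  obtain \<phi> where phi: "sat \<phi> (res E S)" using res_proper_colorable S by blast
  have finS: "finite S" using S finV finite_subset by blast
  let ?k = "card ((\<lambda>v. base (\<phi> v)) ` S)"
  have k3: "?k \<le> 3"
  proof -
    have "(\<lambda>v. base (\<phi> v)) ` S \<subseteq> {C0, C2, C4}" using base_in by blast
    from card_mono[OF _ this] show ?thesis by simp
  qed
  have kS: "?k \<le> card S" using card_image_le[OF finS] .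
  have small: "?k < card S \<or> ?k < card (res E S)"
    using small_sets_dense[OF finS S(1) _ r] k3 kS by linarith
  show ?thesis
  proof (rule quotient_step[OF _ order_refl S(1) phi _ small])
    show "S \<subseteq> V" using S by auto
    show False if "sat \<theta> (res E V)" for \<theta>
      using that ncE by (auto simp: res_vset colorable_def)
  qed (rule that)
qed

text \<open>A set of potential at most 2 would grow to one of potential at most 1. By
  \<open>rho_ge\<close> this is not V, and the induction on the complement applies to it.\<close>

lemma rho_ge3: "S \<noteq> {} \<Longrightarrow> S \<subset> V \<Longrightarrow> 3 \<le> rho E S"
proof (induction "card (V - S)" arbitrary: S rule: less_induct)
  case less
  show ?case
  proof (rule ccontr)
    assume "\<not> ?case"
    then have r: "rho E S \<le> 2" by simp
    then have r': "rho E S \<le> 3" "rho E S \<le> 2 \<or> \<not> rigid S" by simp_all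
    obtain S' where S': "S \<subset> S'" "S' \<subseteq> V" and alt: "rho E S' \<le> rho E S - 2 \<or>
      rho E S' \<le> rho E S - 1 \<and> (\<exists>z u v s t. z \<notin> S \<and> S' = insert z S \<and> u \<in> S \<and> v \<in> S \<and> u \<noteq> v \<and>
        Edge True s {z, u} \<in> E \<and> Edge True t {z, v} \<in> E)"
      by (rule gap_step[OF less.prems r'])
    from alt r have r1: "rho E S' \<le> 1" by linarith
    then have "S' \<subset> V" using rho_ge S'(2) by (cases "S' = V") auto
    moreover have "card (V - S') < card (V - S)"
      using S' finV by (intro psubset_card_mono) auto
    ultimately have "3 \<le> rho E S'" using less.hyps[of S'] S' by auto
    then show False using r1 by simp
  qed
qed

text \<open>A weak edge alone would produce a proper set of potential at most 2. A digon cannot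
  result, since its edges are strong.\<close>

lemma gadget_weak:
  assumes D: "D \<subseteq> V" "D \<noteq> {}" and uv: "u \<in> V - D" "v \<in> V - D" "u \<noteq> v"
    and noext: "\<And>\<phi>. sat \<phi> (res E (V - D)) \<Longrightarrow> allow False s (\<phi> u) (\<phi> v) \<Longrightarrow> False"
  shows False
proof -
  let ?A = "{Edge False s {u, v}}"
  have A: "finite ?A" "loopless ?A" "vset ?A \<subseteq> V - D"
    using uv by (auto simp: loopless_def vset_def[of ?A])
  have nx: "False" if "sat \<phi> (res E (V - D))" "sat \<phi> ?A" for \<phi>
    using that noext[of \<phi>] uv(3) by (simp add: sat_def[of _ ?A] ok_pair)
  obtain A' S where A': "A' \<subseteq> ?A" "A' \<noteq> {}" "A' \<inter> E = {}" "vset A' \<subseteq> S" "S \<subseteq> V - D" "S \<noteq> {}"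
    and alt: "rho E S \<le> 1 + weight A' \<or> (\<exists>s u v. u \<noteq> v \<and> Edge True s {u, v} \<in> A' \<and> Edge True (\<not> s) {u, v} \<in> E \<union> ?A)"
    by (rule gadget[OF D A nx])
  have "A' = ?A" using A'(1,2) by auto
  with alt have "rho E S \<le> 2" by (auto simp: weight_insert)
  moreover have "3 \<le> rho E S" using rho_ge3[of S] A'(5,6) D by auto
  ultimately show False by simp
qed

text \<open>Two strong edges leave a colour for \<open>v\<close> exactly when the switched colours
  of \<open>a\<close> and \<open>b\<close> are not antipodal, and this is what a weak edge between
  them demands.\<close>

lemma not_two_strong:
  assumes v: "v \<in> V" "sdeg v = 2" "wdeg v = 0"
  shows False
proof -
  obtain a s b t where ab: "{e \<in> inc E v. strong e} = {Edge True s {v, a}, Edge True t {v, b}}"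
    "a \<noteq> b" "a \<noteq> v" "b \<noteq> v" "Edge True s {v, a} \<in> E" "Edge True t {v, b} \<in> E"
    by (rule strong_deg_cases[OF v(2)])
  have "{e \<in> inc E v. \<not> strong e} = {}"
    using v(3) finite_inc by (simp add: wdeg_def)
  then have inc: "inc E v = {Edge True s {v, a}, Edge True t {v, b}}"
    using inc_split[of v] ab(1) by (metis Un_empty_right)
  show False
  proof (rule gadget_weak[of "{v}" a b "s \<noteq> t"])
    fix \<phi> assume phi: "sat \<phi> (res E (V - {v}))" and w: "allow False (s \<noteq> t) (\<phi> a) (\<phi> b)"
    then have "flip s (\<phi> a) \<noteq> opp (flip t (\<phi> b))"
      by (simp only: allow_flip allow_not_opp) simp
    then obtain c where c: "near c (flip s (\<phi> a))" "near c (flip t (\<phi> b))" using near_common by blast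
    then have "ok (\<phi>(v := c)) (Edge True s {v, a})" "ok (\<phi>(v := c)) (Edge True t {v, b})"
      using ab(3,4) ab(3,4)[symmetric] by (simp_all add: ok_pair allow_strong)
    then show False
      by (intro no_extension[OF phi, of "\<phi>(v := c)"]) (auto simp: inc)
  qed (use v ab edge_ends in auto)
qed

lemma rho_remove:
  assumes "z \<in> V"
  shows "rho E V = rho E (V - {z}) + 3 - weight (inc E z)"
proof -
  have E: "E = res E (V - {z}) \<union> inc E z" "res E (V - {z}) \<inter> inc E z = {}"
    by (auto simp: res_def inc_def vset_def)
  have "weight E = weight (res E (V - {z})) + weight (inc E z)"
    using weight_Un[OF _ _ E(2)] E(1) finE finite_inc by (metis finite_res)
  moreover have "card V = card (V - {z}) + 1"
    using assms finV by (metis Suc_eq_plus1 card_Suc_Diff1)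
  ultimately show ?thesis by (simp add: rho_def res_vset)
qed

text \<open>By \<open>rho_ge3\<close> a non-rigid S can only grow to V, and \<open>rho_ge\<close>
  permits a drop of just 1. So V is S plus one vertex z with two strong edges. The edges at z weigh
  at most 3 + 3 - 2 = 4, so there are no others, against \<open>not_two_strong\<close>.\<close>

lemma rho_le3_rigid:
  assumes S: "S \<noteq> {}" "S \<subset> V" and r: "rho E S \<le> 3"
  shows "rigid S"
proof (rule ccontr)
  assume nr: "\<not> rigid S"
  then have r': "rho E S \<le> 2 \<or> \<not> rigid S" ..
  obtain S' where S': "S \<subset> S'" "S' \<subseteq> V" and alt: "rho E S' \<le> rho E S - 2 \<or>
    rho E S' \<le> rho E S - 1 \<and> (\<exists>z u v s t. z \<notin> S \<and> S' = insert z S \<and> u \<in> S \<and> v \<in> S \<and> u \<noteq> v \<and>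
      Edge True s {z, u} \<in> E \<and> Edge True t {z, v} \<in> E)"
    by (rule gap_step[OF S r r'])
  have "S' = V" using rho_ge3[of S'] S' alt r by force
  with alt rho_ge r obtain z u v s t where z: "z \<notin> S" "V = insert z S" "u \<in> S" "v \<in> S" "u \<noteq> v"
    "Edge True s {z, u} \<in> E" "Edge True t {z, v} \<in> E" by force
  have "V - {z} = S" using z by auto
  then have "weight (inc E z) \<le> 4" using rho_remove[of z] z rho_ge r by auto
  moreover have "2 \<le> sdeg z"
  proof -
    have "{Edge True s {z, u}, Edge True t {z, v}} \<subseteq> {e \<in> inc E z. strong e}"
      using z by (auto simp: inc_def)
    from card_mono[OF _ this] finite_inc z show ?thesis
      by (auto simp: sdeg_def doubleton_eq_iff split: if_splits)
  qed
  ultimately have "sdeg z = 2" "wdeg z = 0" by (auto simp: weight_inc)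
  then show False using not_two_strong z by blast
qed

lemma rho_ge2: "T \<subseteq> V \<Longrightarrow> T \<noteq> {} \<Longrightarrow> 2 \<le> rho E T"
  using rho_ge3[of T] rho_ge by (cases "T = V") (simp_all add: psubset_eq)

lemma rho_le2_full: "T \<subseteq> V \<Longrightarrow> T \<noteq> {} \<Longrightarrow> rho E T \<le> 2 \<Longrightarrow> T = V"
  using rho_ge3[of T] by (cases "T = V") (simp_all add: psubset_eq)

lemma rho_le3_full: "T \<subseteq> V \<Longrightarrow> 3 < card T \<Longrightarrow> rho E T \<le> 3 \<Longrightarrow> T = V"
  using rho_le3_rigid[of T] by (cases "T = V"; cases "T = {}") (simp_all add: rigid_def psubset_eq)

text \<open>The set found has potential at most 3, is therefore rigid and contains a strong edge
  between \<open>u\<close> and \<open>v\<close>. Since the gadget edge is not in E, that edge has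
  the opposite sign. A digon gives this edge directly.\<close>

lemma gadget_strong:
  assumes D: "D \<subseteq> V" "D \<noteq> {}" and uv: "u \<in> V - D" "v \<in> V - D" "u \<noteq> v"
    and noext: "\<And>\<phi>. sat \<phi> (res E (V - D)) \<Longrightarrow> allow True s (\<phi> u) (\<phi> v) \<Longrightarrow> False"
  shows "Edge True (\<not> s) {u, v} \<in> E"
proof -
  let ?A = "{Edge True s {u, v}}"
  have A: "finite ?A" "loopless ?A" "vset ?A \<subseteq> V - D"
    using uv by (auto simp: loopless_def vset_def[of ?A])
  have nx: "False" if "sat \<phi> (res E (V - D))" "sat \<phi> ?A" for \<phi>
    using that noext[of \<phi>] uv(3) by (simp add: sat_def[of _ ?A] ok_pair)
  obtain A' S where A': "A' \<subseteq> ?A" "A' \<noteq> {}" "A' \<inter> E = {}" "vset A' \<subseteq> S" "S \<subseteq> V - D" "S \<noteq> {}"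
    and alt: "rho E S \<le> 1 + weight A' \<or> (\<exists>s u v. u \<noteq> v \<and> Edge True s {u, v} \<in> A' \<and> Edge True (\<not> s) {u, v} \<in> E \<union> ?A)"
    by (rule gadget[OF D A nx])
  have A: "A' = ?A" using A'(1,2) by auto
  have SV: "S \<subset> V" using A'(5) D by auto
  show ?thesis
    using alt
  proof
    assume "rho E S \<le> 1 + weight A'"
    then have "rigid S" using A by (intro rho_le3_rigid[OF A'(6) SV]) (simp add: weight_insert)
    moreover have "u \<in> S" "v \<in> S" using A A'(4) by (auto simp: vset_def)
    ultimately obtain t where "Edge True t {u, v} \<in> E" using uv by (auto simp: rigid_def)
    then show ?thesis using A'(3) A by (cases s; cases t) auto
  next
    assume "\<exists>s u v. u \<noteq> v \<and> Edge True s {u, v} \<in> A' \<and> Edge True (\<not> s) {u, v} \<in> E \<union> ?A"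
    then show ?thesis using A by auto
  qed
qed

text \<open>If the critical graph uses one added edge, the earlier cases recur. If it uses both, the
  bound is 1 + 3 = 4, too weak for a contradiction by itself; it is refuted later by putting D
  back.\<close>

lemma gadget_strong_weak:
  assumes D: "D \<subseteq> V" "D \<noteq> {}" and uv: "u \<in> V - D" "v \<in> V - D" "u \<noteq> v"
    and pq: "p \<in> V - D" "q \<in> V - D" "p \<noteq> q"
    and noext: "\<And>\<phi>. sat \<phi> (res E (V - D)) \<Longrightarrow> allow True s (\<phi> u) (\<phi> v) \<Longrightarrow>
      allow False t (\<phi> p) (\<phi> q) \<Longrightarrow> False"
  shows "Edge True (\<not> s) {u, v} \<in> E \<or> (\<exists>S\<subseteq>V - D. {u, v, p, q} \<subseteq> S \<and> rho E S \<le> 4)"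
proof -
  let ?e = "Edge True s {u, v}" and ?f = "Edge False t {p, q}"
  have A: "finite {?e, ?f}" "loopless {?e, ?f}" "vset {?e, ?f} \<subseteq> V - D"
    using uv pq by (auto simp: loopless_def vset_def[of "{?e, ?f}"])
  have nx: "False" if "sat \<phi> (res E (V - D))" "sat \<phi> {?e, ?f}" for \<phi>
    using that noext[of \<phi>] uv(3) pq(3) by (simp add: sat_def[of _ "{?e, ?f}"] ok_pair)
  obtain A' S where A': "A' \<subseteq> {?e, ?f}" "A' \<noteq> {}" "A' \<inter> E = {}" "vset A' \<subseteq> S" "S \<subseteq> V - D" "S \<noteq> {}"
    and alt: "rho E S \<le> 1 + weight A' \<or> (\<exists>s u v. u \<noteq> v \<and> Edge True s {u, v} \<in> A' \<and> Edge True (\<not> s) {u, v} \<in> E \<union> {?e, ?f})"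
    by (rule gadget[OF D A nx])
  have SV: "S \<subset> V" using A'(5) D by auto
  show ?thesis
    using alt
  proof
    assume r: "rho E S \<le> 1 + weight A'"
    consider "A' = {?e}" | "A' = {?f}" | "A' = {?e, ?f}" using A'(1,2) by blast
    then show ?thesis
    proof cases
      case 1
      then have "rigid S" using r by (intro rho_le3_rigid[OF A'(6) SV]) (simp add: weight_insert)
      moreover have "u \<in> S" "v \<in> S" using 1 A'(4) by (auto simp: vset_def)
      ultimately obtain t where "Edge True t {u, v} \<in> E" using uv by (auto simp: rigid_def)
      then show ?thesis using A'(3) 1 by (cases s; cases t) auto
    next
      case 2
      then have "rho E S \<le> 2" using r by (simp add: weight_insert)
      moreover have "3 \<le> rho E S" by (rule rho_ge3[OF A'(6) SV])
      ultimately show ?thesis by simp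
    next
      case 3
      then have "rho E S \<le> 4" using r by (simp add: weight_insert)
      moreover have "{u, v, p, q} \<subseteq> S" using 3 A'(4) by (auto simp: vset_def)
      ultimately show ?thesis using A'(5) by auto
    qed
  next
    assume "\<exists>s u v. u \<noteq> v \<and> Edge True s {u, v} \<in> A' \<and> Edge True (\<not> s) {u, v} \<in> E \<union> {?e, ?f}"
    then show ?thesis using A'(1) by (auto simp: subset_iff)
  qed
qed

section \<open>Vertices of small degree\<close>

text \<open>The edges at \<open>z\<close> weigh at most 4. With s strong and w weak ones, 2s + w <=
  4 and 3s + w >= 6 leave only s = 2 and w = 0.\<close>

lemma low_vertex:
  assumes "z \<in> V" "rho E (V - {z}) \<le> 3" "Edge False s {z, u} \<in> E"
  shows False
proof -
  have "weight (inc E z) \<le> 4" using rho_remove[OF assms(1)] assms(2) rho_ge by simp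
  moreover have "wdeg z \<noteq> 0"
  proof -
    have "Edge False s {z, u} \<in> {e \<in> inc E z. \<not> strong e}" using assms(3) by (simp add: inc_def)
    then show ?thesis unfolding wdeg_def using finite_inc by (metis (no_types, lifting) card_0_eq empty_iff finite_Collect_conjI finite_subset mem_Collect_eq subsetI)
  qed
  ultimately show False using degree_bound[OF assms(1)] by (simp add: weight_inc)
qed

section \<open>Vertices with two strong edges and one weak edge\<close>

definition deficient_at :: "'v \<Rightarrow> bool \<Rightarrow> 'v \<Rightarrow> bool \<Rightarrow> 'v \<Rightarrow> bool \<Rightarrow> 'v \<Rightarrow> bool" where
  "deficient_at x s1 a s2 b s3 c \<longleftrightarrow> x \<noteq> a \<and> x \<noteq> b \<and> x \<noteq> c \<and> a \<noteq> b \<and>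
     inc E x = {Edge True s1 {x, a}, Edge True s2 {x, b}, Edge False s3 {x, c}}"

lemma deficient_at_sym: "deficient_at x s1 a s2 b s3 c \<Longrightarrow> deficient_at x s2 b s1 a s3 c"
  by (auto simp: deficient_at_def)

lemma deficient_at_ex:
  assumes "sdeg x = 2" "wdeg x = 1"
  obtains s1 a s2 b s3 c where "deficient_at x s1 a s2 b s3 c"
proof -
  obtain a s1 b s2 where ab: "{e \<in> inc E x. strong e} = {Edge True s1 {x, a}, Edge True s2 {x, b}}"
    "a \<noteq> b" "a \<noteq> x" "b \<noteq> x" "Edge True s1 {x, a} \<in> E" "Edge True s2 {x, b} \<in> E"
    by (rule strong_deg_cases[OF assms(1)])
  obtain c s3 where c: "{e \<in> inc E x. \<not> strong e} = {Edge False s3 {x, c}}" "c \<noteq> x" "Edge False s3 {x, c} \<in> E"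
    by (rule weak_deg1_cases[OF assms(2)])
  have "inc E x = {Edge True s1 {x, a}, Edge True s2 {x, b}, Edge False s3 {x, c}}"
    by (subst inc_split) (simp only: ab(1) c(1) insert_is_Un[symmetric] Un_insert_left Un_empty_left)
  then have "deficient_at x s1 a s2 b s3 c"
    unfolding deficient_at_def using ab(2-4) c(2) by auto
  then show ?thesis by (rule that)
qed

lemma deficient_edges:
  assumes "deficient_at x s1 a s2 b s3 c"
  shows "Edge True s1 {x, a} \<in> E" "Edge True s2 {x, b} \<in> E" "Edge False s3 {x, c} \<in> E"
    "x \<in> V" "a \<in> V" "b \<in> V" "c \<in> V"
proof -
  have "Edge True s1 {x, a} \<in> inc E x" "Edge True s2 {x, b} \<in> inc E x" "Edge False s3 {x, c} \<in> inc E x"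
    using assms by (simp_all add: deficient_at_def)
  then show e: "Edge True s1 {x, a} \<in> E" "Edge True s2 {x, b} \<in> E" "Edge False s3 {x, c} \<in> E"
    by (simp_all add: inc_def)
  show "x \<in> V" "a \<in> V" "b \<in> V" "c \<in> V"
    using e edge_ends by blast+
qed

text \<open>If the switched colours of \<open>a\<close> and \<open>b\<close> are near each other, at
  least two colours of \<open>x\<close> suit both strong edges, and one of them also suits the weak
  edge. So an edge enforcing nearness would make E colourable, and its opposite must be present. The
  triangle so formed is positive.\<close>

lemma deficient_triangle:
  assumes d: "deficient_at x s1 a s2 b s3 c"
  shows "Edge True (s1 = s2) {a, b} \<in> E"
proof -
  have ne: "x \<noteq> a" "x \<noteq> b" "x \<noteq> c" "a \<noteq> b"
    and inc: "inc E x = {Edge True s1 {x, a}, Edge True s2 {x, b}, Edge False s3 {x, c}}"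
    using d by (auto simp: deficient_at_def)
  have "Edge True (\<not> (s1 \<noteq> s2)) {a, b} \<in> E"
  proof (rule gadget_strong[of "{x}" a b "s1 \<noteq> s2"])
    fix \<phi> assume phi: "sat \<phi> (res E (V - {x}))" and "allow True (s1 \<noteq> s2) (\<phi> a) (\<phi> b)"
    then have "near (flip s1 (\<phi> a)) (flip s2 (\<phi> b))" by (simp only: allow_flip allow_near)
    from near_pair_extend[OF this, of "flip s3 (\<phi> c)"] obtain y where
      y: "near y (flip s1 (\<phi> a))" "near y (flip s2 (\<phi> b))" "y \<noteq> opp (flip s3 (\<phi> c))" by auto
    let ?\<theta> = "\<phi>(x := y)"
    have "ok ?\<theta> (Edge True s1 {x, a})" "ok ?\<theta> (Edge True s2 {x, b})" "ok ?\<theta> (Edge False s3 {x, c})"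
      using y ne by (simp_all add: ok_pair allow_strong allow_weak)
    then show False
      by (intro no_extension[OF phi, of ?\<theta>]) (auto simp: inc)
  qed (use ne deficient_edges[OF d] in auto)
  then show ?thesis by simp
qed

text \<open>The triangle puts \<open>x\<close> near two switched colours that are far apart, so
  \<open>x\<close> is neither equal nor antipodal to \<open>a\<close>. A weak edge between them
  would be redundant, which criticality excludes.\<close>

lemma deficient_weak_neq:
  assumes d: "deficient_at x s1 a s2 b s3 c"
  shows "c \<noteq> a"
proof
  assume ca: "c = a"
  have ne: "x \<noteq> a" "x \<noteq> b" "a \<noteq> b" using d by (auto simp: deficient_at_def)
  let ?e = "Edge False s3 {x, c}"
  have "?e \<in> E" using deficient_edges[OF d] by simp
  then obtain \<phi> where phi: "sat \<phi> (E - {?e})" using crit by (auto simp: critical_def colorable_def)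
  have "ok \<phi> (Edge True s1 {x, a})" "ok \<phi> (Edge True s2 {x, b})" "ok \<phi> (Edge True (s1 = s2) {a, b})"
    using phi deficient_edges[OF d] deficient_triangle[OF d] by (auto simp: sat_def)
  then have 1: "near (\<phi> x) (flip s1 (\<phi> a))" "near (\<phi> x) (flip s2 (\<phi> b))" "near (\<phi> a) (flip (s1 = s2) (\<phi> b))"
    using ne by (simp_all add: ok_pair allow_strong)
  have "near (flip s1 (\<phi> a)) (opp (flip s2 (\<phi> b)))"
    using 1(3) by (cases s1; cases s2) (simp_all add: flip_def near_opp_iff)
  then have "\<not> near (flip s1 (\<phi> a)) (flip s2 (\<phi> b))" by (simp add: near_opp)
  from near_far_neq[OF 1(1,2) this, of "s1 = s3"] have "\<phi> x \<noteq> opp (flip s3 (\<phi> a))"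
    by (cases s1; cases s3) (simp_all add: flip_def)
  then have "ok \<phi> ?e" using ne ca by (simp add: ok_pair allow_weak)
  then have "sat \<phi> E" using phi by (auto simp: sat_def)
  then show False using ncE by (auto simp: colorable_def)
qed

text \<open>Otherwise {a, b, c, x} carries weight 9 and is all of V. Removing \<open>c\<close>
  leaves a triangle of potential at most 3, so \<open>low_vertex\<close> applies to \<open>c\<close>
  and its weak edge to \<open>x\<close>.\<close>

lemma deficient_not_adjacent:
  assumes d: "deficient_at x s1 a s2 b s3 c"
  shows "Edge True s {a, c} \<notin> E"
proof
  assume ac: "Edge True s {a, c} \<in> E"
  have ne: "x \<noteq> a" "x \<noteq> b" "x \<noteq> c" "a \<noteq> b" using d by (auto simp: deficient_at_def)
  have ca: "c \<noteq> a" "c \<noteq> b"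
    using deficient_weak_neq[OF d] deficient_weak_neq[OF deficient_at_sym[OF d]] by auto
  note e = deficient_edges[OF d] and ab = deficient_triangle[OF d]
  let ?T = "{a, b, c, x}"
  let ?B = "{Edge True s1 {x, a}, Edge True s2 {x, b}, Edge True (s1 = s2) {a, b}}"
  let ?F = "?B \<union> {Edge True s {a, c}, Edge False s3 {x, c}}"
  have wF0: "weight ?B = 6"
    using ne by (simp add: weight_insert doubleton_eq_iff)
  have wF: "weight ?F = 9"
    using ne ca by (simp add: weight_insert doubleton_eq_iff)
  have "rho E ?T \<le> 3 * int (card ?T) - weight ?F"
    by (rule rho_le[OF finE]) (use e ab ac in auto)
  moreover have c4: "card ?T = 4" using ne ca by simp
  ultimately have "?T = V" using rho_le3_full[of ?T] e wF by auto
  then have Vc: "V - {c} = {a, b, x}" using ca ne by auto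
  have "rho E {a, b, x} \<le> 3 * int (card {a, b, x}) - weight ?B"
    by (rule rho_le[OF finE]) (use e ab in auto)
  then have "rho E (V - {c}) \<le> 3" using wF0 ne Vc by simp
  moreover have "Edge False s3 {c, x} \<in> E" using e(3) by (simp add: insert_commute)
  ultimately show False using low_vertex e(7) by blast
qed

text \<open>The count is 4 + 3 * 2 - 9 = 1, below the minimum 2. This refutes the second alternative
  of \<open>gadget_strong_weak\<close> when \<open>x\<close> and \<open>a\<close> are
  deleted.\<close>

lemma rho_extend_pair:
  assumes "x \<noteq> a" "x \<in> V" "a \<in> V" "S \<subseteq> V - {x, a}" "rho E S \<le> 4" "F \<subseteq> E" "weight F = 9"
    "vset F \<subseteq> S \<union> {x, a}" "\<And>e. e \<in> F \<Longrightarrow> x \<in> ext e \<or> a \<in> ext e"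
  shows False
proof -
  let ?T = "S \<union> {x, a}"
  have TV: "?T \<subseteq> V" using assms by auto
  then have fin: "finite ?T" using finV finite_subset by blast
  have TS: "?T - S = {x, a}" using assms(4) by auto
  have "rho E ?T \<le> rho E S + 3 * int (card (?T - S)) - weight F"
    by (rule rho_extend[OF finE fin _ assms(6,8)]) (use assms(4,9) in auto)
  then have "rho E ?T \<le> 1" using assms(1,5,7) unfolding TS by simp
  then show False using rho_ge2[OF TV] by simp
qed

text \<open>The colours x' and a' are taken after switching along the edge between \<open>x\<close>
  and \<open>a\<close>. In these terms the triangle asks precisely for what the
  \<open>triangle_extend\<close> lemmas supply; \<open>a\<close> then receives
  \<open>flip s1 a'\<close>.\<close>

lemma deficient_extend_pair:
  assumes d: "deficient_at x s1 a s2 b s3 c" and phi: "sat \<phi> (res E (V - {x, a}))"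
    and inc: "inc E a = {Edge True s1 {x, a}, Edge True (s1 = s2) {a, b}} \<union> M"
    and xy: "near x' (flip s2 (\<phi> b))" "near x' a'" "\<not> near a' (flip s2 (\<phi> b))" "x' \<noteq> opp (flip s3 (\<phi> c))"
    and M: "\<And>e. e \<in> M \<Longrightarrow> \<exists>k s u. e = Edge k s {a, u} \<and> u \<noteq> a \<and> u \<noteq> x \<and> allow k s (flip s1 a') (\<phi> u)"
  shows False
proof -
  have ne: "x \<noteq> a" "x \<noteq> b" "x \<noteq> c" "a \<noteq> b"
    and incx: "inc E x = {Edge True s1 {x, a}, Edge True s2 {x, b}, Edge False s3 {x, c}}"
    using d by (auto simp: deficient_at_def)
  have ca: "c \<noteq> a" by (rule deficient_weak_neq[OF d])
  let ?\<theta> = "\<phi>(x := x', a := flip s1 a')"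
  have 1: "ok ?\<theta> (Edge True s1 {x, a})" "ok ?\<theta> (Edge True s2 {x, b})" "ok ?\<theta> (Edge False s3 {x, c})"
    using xy ne ca by (simp_all add: ok_pair allow_strong allow_weak)
  have "near (flip s1 a') (flip (s1 = s2) (\<phi> b)) \<longleftrightarrow> near a' (opp (flip s2 (\<phi> b)))"
    by (cases s1; cases s2) (simp_all add: flip_def near_opp_iff)
  then have 2: "ok ?\<theta> (Edge True (s1 = s2) {a, b})"
    using xy ne by (simp add: ok_pair allow_strong near_opp)
  have 3: "ok ?\<theta> e" if "e \<in> M" for e
  proof -
    from M[OF that] obtain k s u where "e = Edge k s {a, u}" "u \<noteq> a" "u \<noteq> x" "allow k s (flip s1 a') (\<phi> u)"
      by auto
    then show ?thesis using ne by (simp add: ok_pair)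
  qed
  show False
  proof (rule no_extension[OF phi, of ?\<theta>])
    fix e v assume "e \<in> inc E v" "v \<in> {x, a}"
    then have "e \<in> inc E x \<or> e \<in> inc E a" by auto
    then show "ok ?\<theta> e" using 1 2 3 unfolding inc incx by blast
  qed simp
qed

text \<open>After deleting \<open>x\<close> and \<open>a\<close>, a strong edge that makes
  \<open>c\<close> near \<open>b\<close> and a weak edge that keeps \<open>z\<close> different from
  \<open>b\<close> prepare for \<open>triangle_extend_strong\<close>. Neither outcome of the gadget
  can occur: \<open>b\<close> and \<open>c\<close> are not strongly adjacent, and putting
  \<open>x\<close> and \<open>a\<close> back adds weight 9.\<close>

lemma deficient_nbr_strong_three:
  assumes d: "deficient_at x s1 a s2 b s3 c" and deg: "sdeg a = 3" "wdeg a = 0"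
  shows False
proof -
  have ne: "x \<noteq> a" "x \<noteq> b" "x \<noteq> c" "a \<noteq> b" using d by (auto simp: deficient_at_def)
  have ca: "c \<noteq> a" "c \<noteq> b"
    using deficient_weak_neq[OF d] deficient_weak_neq[OF deficient_at_sym[OF d]] by auto
  note e = deficient_edges[OF d] and ab = deficient_triangle[OF d]
  let ?P = "{Edge True s1 {x, a}, Edge True (s1 = s2) {a, b}}"
  have noweak: "{e \<in> inc E a. \<not> strong e} = {}"
    using deg(2) finite_inc by (simp add: wdeg_def)
  then have inc_strong: "inc E a = {e \<in> inc E a. strong e}" by auto
  then have card3: "card (inc E a) = 3" using deg(1) by (simp add: sdeg_def)
  have P: "?P \<subseteq> inc E a" using e ab by (simp add: inc_def)
  have "card ?P = 2" using ne by (simp add: doubleton_eq_iff)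
  then have "card (inc E a - ?P) = 1"
    using card3 card_Diff_subset[OF _ P] by simp
  then obtain f where f: "inc E a - ?P = {f}" by (rule card_1_singletonE)
  then have "f \<in> inc E a" "f \<notin> ?P" by blast+
  then have f': "f \<in> E" "a \<in> ext f" "f \<notin> ?P" "strong f" using noweak by (auto simp: inc_def)
  obtain k s4 z where fz: "f = Edge k s4 {a, z}" "a \<noteq> z" "z \<in> V"
    using edge_at[OF f'(1,2)] by metis
  have fz': "f = Edge True s4 {a, z}" using fz f'(4) by simp
  have zx: "z \<noteq> x"
    using strong_edge_unique[of s4 a z s1] fz' f' e(1) by (auto simp: insert_commute)
  have zb: "z \<noteq> b"
    using strong_edge_unique[of s4 a z "s1 = s2"] fz' f' ab by auto
  have inc: "inc E a = ?P \<union> {f}" using f P by blast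
  \<comment> \<open>The weak edge has to forbid equal switched colours rather than antipodal ones,
    so its sign is the complement of the usual one.\<close>
  let ?t = "s2 = (s1 \<noteq> s4)"
  have "Edge True (\<not> (s2 \<noteq> s3)) {b, c} \<in> E \<or> (\<exists>S\<subseteq>V - {x, a}. {b, c, b, z} \<subseteq> S \<and> rho E S \<le> 4)"
  proof (rule gadget_strong_weak[of "{x, a}" b c b z "s2 \<noteq> s3" ?t])
    fix \<phi> assume phi: "sat \<phi> (res E (V - {x, a}))" and st: "allow True (s2 \<noteq> s3) (\<phi> b) (\<phi> c)"
      and wk: "allow False ?t (\<phi> b) (\<phi> z)"
    have 1: "near (flip s3 (\<phi> c)) (flip s2 (\<phi> b))"
      using st by (simp only: allow_flip allow_near near_commute)
    have 2: "flip (s1 \<noteq> s4) (\<phi> z) \<noteq> flip s2 (\<phi> b)"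
      using wk by (cases s1; cases s2; cases s4) (auto simp: allow_weak flip_def)
    from triangle_extend_strong[OF 1 2] obtain x' a' where xa: "near x' (flip s2 (\<phi> b))" "near x' a'"
      "\<not> near a' (flip s2 (\<phi> b))" "x' \<noteq> opp (flip s3 (\<phi> c))" "near a' (flip (s1 \<noteq> s4) (\<phi> z))" by auto
    have "allow True s4 (flip s1 a') (\<phi> z)"
      using xa(5) by (simp only: allow_strong near_flip_flip)
    then show False
      by (intro deficient_extend_pair[OF d phi inc xa(1-4)]) (use fz' fz(2) zx in blast)
  qed (use e ne ca fz zx zb in auto)
  then show False
  proof
    assume "Edge True (\<not> (s2 \<noteq> s3)) {b, c} \<in> E"
    then show False using deficient_not_adjacent[OF deficient_at_sym[OF d]] by blast
  next
    assume "\<exists>S\<subseteq>V - {x, a}. {b, c, b, z} \<subseteq> S \<and> rho E S \<le> 4"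
    then obtain S where S: "S \<subseteq> V - {x, a}" "{b, c, z} \<subseteq> S" "rho E S \<le> 4" by auto
    let ?F = "{Edge True s1 {x, a}, Edge True s2 {x, b}, Edge True (s1 = s2) {a, b}, Edge True s4 {a, z},
      Edge False s3 {x, c}}"
    show False
      by (rule rho_extend_pair[OF ne(1) e(4,5) S(1,3), of ?F])
        (use S(2) e ab f' fz' ne zx zb fz(2) in
          \<open>auto simp: weight_insert doubleton_eq_iff\<close>)
  qed
qed

text \<open>After deleting \<open>x\<close> and \<open>a\<close>, a strong edge that puts y far from
  \<open>b\<close> makes both vertices colourable again. So \<open>b\<close> and y are strongly
  adjacent, which is impossible next to the deficient vertex \<open>a\<close>.\<close>

lemma deficient_nbr_not_deficient:
  assumes d: "deficient_at x s1 a s2 b s3 c" and deg: "sdeg a = 2" "wdeg a = 1"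
  shows False
proof -
  have ne: "x \<noteq> a" "x \<noteq> b" "x \<noteq> c" "a \<noteq> b" using d by (auto simp: deficient_at_def)
  note e = deficient_edges[OF d] and ab = deficient_triangle[OF d]
  let ?P = "{Edge True s1 {x, a}, Edge True (s1 = s2) {a, b}}"
  have P: "?P \<subseteq> {e \<in> inc E a. strong e}" using e ab by (simp add: inc_def)
  have "card ?P = 2" using ne by (simp add: doubleton_eq_iff)
  then have strong_inc: "{e \<in> inc E a. strong e} = ?P"
    using card_subset_eq[OF _ P] deg(1) finite_inc by (simp add: sdeg_def)
  obtain y s4 where y: "{e \<in> inc E a. \<not> strong e} = {Edge False s4 {a, y}}" "y \<noteq> a" "Edge False s4 {a, y} \<in> E"
    by (rule weak_deg1_cases[OF deg(2)])
  have inc: "inc E a = ?P \<union> {Edge False s4 {a, y}}"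
    by (subst inc_split) (simp only: strong_inc y(1))
  have d': "deficient_at a s1 x (s1 = s2) b s4 y"
    unfolding deficient_at_def inc using ne y(2) by (simp add: insert_commute[of a x "{}"] Un_commute[of _ "{Edge False s4 {a, y}}"]) blast
  have yx: "y \<noteq> x" "y \<noteq> b"
    using deficient_weak_neq[OF d'] deficient_weak_neq[OF deficient_at_sym[OF d']] by auto
  have yV: "y \<in> V" using edge_ends[OF y(3)] by simp
  let ?t = "s2 \<noteq> (s1 = s4)"
  have "Edge True (\<not> ?t) {b, y} \<in> E"
  proof (rule gadget_strong[of "{x, a}" b y ?t])
    fix \<phi> assume phi: "sat \<phi> (res E (V - {x, a}))" and st: "allow True ?t (\<phi> b) (\<phi> y)"
    have "near (flip s2 (\<phi> b)) (opp (flip (s1 \<noteq> s4) (\<phi> y)))"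
      using st by (cases s1; cases s2; cases s4) (simp_all add: allow_strong flip_def near_opp_iff)
    then have 1: "\<not> near (flip (s1 \<noteq> s4) (\<phi> y)) (flip s2 (\<phi> b))"
      by (simp add: near_opp near_commute)
    \<comment> \<open>There is a single weak edge at \<open>a\<close>, so the colour of
      \<open>c\<close> itself is taken for the remaining parameter of
      \<open>triangle_extend_weak\<close>.\<close>
    have 2: "flip s3 (\<phi> c) \<noteq> opp (flip s3 (\<phi> c))" by (cases "flip s3 (\<phi> c)") auto
    from triangle_extend_weak[OF 1 2] obtain x' a' where xa: "near x' (flip s2 (\<phi> b))" "near x' a'"
      "\<not> near a' (flip s2 (\<phi> b))" "x' \<noteq> opp (flip s3 (\<phi> c))" "a' \<noteq> opp (flip (s1 \<noteq> s4) (\<phi> y))" by auto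
    have "allow False s4 (flip s1 a') (\<phi> y)"
      using xa(5) by (simp only: allow_weak flip_eq_opp_flip) simp
    then show False
      by (intro deficient_extend_pair[OF d phi inc xa(1-4)]) (use yx y(2) in blast)
  qed (use e ne y(2) yx yV in auto)
  then show False using deficient_not_adjacent[OF deficient_at_sym[OF d']] by blast
qed

text \<open>Putting \<open>y\<close> far from \<open>b\<close> disarms the weak edge to
  \<open>y\<close>. The other weak edge, to \<open>z\<close>, must not conspire with the one from
  \<open>x\<close> to \<open>c\<close>; preventing this takes a weak edge between \<open>c\<close>
  and \<open>z\<close>. If c = z that condition either always holds or always fails, and in the
  failing case a different strong edge is added.\<close>

lemma deficient_nbr_two_weak_aux:
  assumes d: "deficient_at x s1 a s2 b s3 c"
    and inc: "inc E a = {Edge True s1 {x, a}, Edge True (s1 = s2) {a, b}} \<union> {Edge False s4 {a, y}, Edge False s5 {a, z}}"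
    and ne': "y \<noteq> a" "z \<noteq> a" "y \<noteq> x" "z \<noteq> x" "y \<noteq> b" "z \<noteq> b" "y \<noteq> z \<or> s4 \<noteq> s5"
  shows "\<exists>s. Edge True s {b, y} \<in> E"
proof -
  have ne: "x \<noteq> a" "x \<noteq> b" "x \<noteq> c" "a \<noteq> b" using d by (auto simp: deficient_at_def)
  have ca: "c \<noteq> a" "c \<noteq> b"
    using deficient_weak_neq[OF d] deficient_weak_neq[OF deficient_at_sym[OF d]] by auto
  note e = deficient_edges[OF d] and ab = deficient_triangle[OF d]
  have "Edge False s4 {a, y} \<in> inc E a" "Edge False s5 {a, z} \<in> inc E a" by (simp_all add: inc)
  then have yz: "Edge False s4 {a, y} \<in> E" "Edge False s5 {a, z} \<in> E" by (simp_all add: inc_def)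
  then have yzV: "y \<in> V" "z \<in> V" using edge_ends by blast+
  let ?t = "s2 \<noteq> (s1 = s4)" and ?u = "s3 \<noteq> (s1 \<noteq> s5)"
  have extend: False if phi: "sat \<phi> (res E (V - {x, a}))"
    and ex: "\<exists>x' a'. near x' (flip s2 (\<phi> b)) \<and> near x' a' \<and> \<not> near a' (flip s2 (\<phi> b)) \<and>
      x' \<noteq> opp (flip s3 (\<phi> c)) \<and> a' \<noteq> opp (flip (s1 \<noteq> s4) (\<phi> y)) \<and> a' \<noteq> opp (flip (s1 \<noteq> s5) (\<phi> z))" for \<phi>
  proof -
    from ex obtain x' a' where xa: "near x' (flip s2 (\<phi> b))" "near x' a'" "\<not> near a' (flip s2 (\<phi> b))"
      "x' \<noteq> opp (flip s3 (\<phi> c))" "a' \<noteq> opp (flip (s1 \<noteq> s4) (\<phi> y))" "a' \<noteq> opp (flip (s1 \<noteq> s5) (\<phi> z))" by auto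
    have "allow False s4 (flip s1 a') (\<phi> y)" "allow False s5 (flip s1 a') (\<phi> z)"
      using xa(5,6) by (simp_all only: allow_weak flip_eq_opp_flip) simp_all
    then show False
      by (intro deficient_extend_pair[OF d phi inc xa(1-4)]) (use ne' in blast)
  qed
  have far: "\<not> near (flip (s1 \<noteq> s4) (\<phi> y)) (flip s2 (\<phi> b))" if "allow True ?t (\<phi> b) (\<phi> y)" for \<phi>
  proof -
    have "near (flip s2 (\<phi> b)) (opp (flip (s1 \<noteq> s4) (\<phi> y)))"
      using that by (cases s1; cases s2; cases s4) (simp_all add: allow_strong flip_def near_opp_iff)
    then show ?thesis by (simp add: near_opp near_commute)
  qed
  have weak: "flip s3 (\<phi> c) \<noteq> opp (flip (s1 \<noteq> s5) (\<phi> z))" if "allow False ?u (\<phi> c) (\<phi> z)" for \<phi>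
    using that by (simp only: allow_weak flip_eq_opp_flip) simp
  show ?thesis
  proof (cases "c = z")
    case False
    have "Edge True (\<not> ?t) {b, y} \<in> E \<or> (\<exists>S\<subseteq>V - {x, a}. {b, y, c, z} \<subseteq> S \<and> rho E S \<le> 4)"
    proof (rule gadget_strong_weak[of "{x, a}" b y c z ?t ?u])
      fix \<phi> assume phi: "sat \<phi> (res E (V - {x, a}))" "allow True ?t (\<phi> b) (\<phi> y)" "allow False ?u (\<phi> c) (\<phi> z)"
      show False
        by (rule extend[OF phi(1) triangle_extend_weak[OF far[OF phi(2)] weak[OF phi(3)]]])
    qed (use e ne ca ne' yzV False in auto)
    then show ?thesis
    proof
      assume "\<exists>S\<subseteq>V - {x, a}. {b, y, c, z} \<subseteq> S \<and> rho E S \<le> 4"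
      then obtain S where S: "S \<subseteq> V - {x, a}" "{b, y, c, z} \<subseteq> S" "rho E S \<le> 4" by auto
      let ?F = "{Edge True s1 {x, a}, Edge True s2 {x, b}, Edge True (s1 = s2) {a, b}, Edge False s4 {a, y},
        Edge False s5 {a, z}, Edge False s3 {x, c}}"
      have "weight ?F = 9"
        using ne ne' ca by (auto simp: weight_insert doubleton_eq_iff)
      then have False
        by (intro rho_extend_pair[OF ne(1) e(4,5) S(1,3), of ?F])
          (use S(2) e ab yz in auto)
      then show ?thesis ..
    qed blast
  next
    case True
    show ?thesis
    proof (cases "s3 = (s1 \<noteq> s5)")
      case eq: True
      have "Edge True (\<not> ?t) {b, y} \<in> E"
      proof (rule gadget_strong[of "{x, a}" b y ?t])
        fix \<phi> assume phi: "sat \<phi> (res E (V - {x, a}))" "allow True ?t (\<phi> b) (\<phi> y)"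
        have 2: "flip s3 (\<phi> c) \<noteq> opp (flip (s1 \<noteq> s5) (\<phi> z))"
          unfolding True eq by (cases "flip (s1 \<noteq> s5) (\<phi> z)") auto
        show False
          by (rule extend[OF phi(1) triangle_extend_weak[OF far[OF phi(2)] 2]])
      qed (use e ne ne' yzV in auto)
      then show ?thesis by blast
    next
      \<comment> \<open>Now the colour that \<open>z\<close> denies to \<open>a\<close> is the
        switched colour of \<open>c\<close>. This is avoided automatically once a strong edge makes
        \<open>c\<close> near \<open>b\<close>.\<close>
      case neq: False
      have "Edge True (\<not> (s2 \<noteq> s3)) {b, c} \<in> E"
      proof (rule gadget_strong[of "{x, a}" b c "s2 \<noteq> s3"])
        fix \<phi> assume phi: "sat \<phi> (res E (V - {x, a}))" and st: "allow True (s2 \<noteq> s3) (\<phi> b) (\<phi> c)"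
        have 1: "near (flip s3 (\<phi> c)) (flip s2 (\<phi> b))"
          using st by (simp only: allow_flip allow_near near_commute)
        have 2: "flip s3 (\<phi> c) = opp (flip (s1 \<noteq> s5) (\<phi> z))"
          using neq True by (cases s1; cases s3; cases s5) (auto simp: flip_def)
        show False
          using extend[OF phi] triangle_extend_double[OF 1, of "flip (s1 \<noteq> s4) (\<phi> y)"] 2 by metis
      qed (use e ne ca in auto)
      then have False using deficient_not_adjacent[OF deficient_at_sym[OF d]] by blast
      then show ?thesis ..
    qed
  qed
qed

text \<open>Using the auxiliary lemma for both orders of the weak edges makes \<open>b\<close>
  strongly adjacent to y and z. Then x, a, b, y, z form a set so dense that it must be V, but
  \<open>c\<close> is outside it because \<open>b\<close> and \<open>c\<close> are not strongly
  adjacent.\<close>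

lemma deficient_nbr_two_weak:
  assumes d: "deficient_at x s1 a s2 b s3 c" and deg: "sdeg a = 2" "wdeg a = 2"
  shows False
proof -
  have ne: "x \<noteq> a" "x \<noteq> b" "x \<noteq> c" "a \<noteq> b"
    and incx: "inc E x = {Edge True s1 {x, a}, Edge True s2 {x, b}, Edge False s3 {x, c}}"
    using d by (auto simp: deficient_at_def)
  have ca: "c \<noteq> a" "c \<noteq> b"
    using deficient_weak_neq[OF d] deficient_weak_neq[OF deficient_at_sym[OF d]] by auto
  note e = deficient_edges[OF d] and ab = deficient_triangle[OF d]
  let ?P = "{Edge True s1 {x, a}, Edge True (s1 = s2) {a, b}}"
  have P: "?P \<subseteq> {e \<in> inc E a. strong e}" using e ab by (simp add: inc_def)
  have "card ?P = 2" using ne by (simp add: doubleton_eq_iff)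
  then have strong_inc: "{e \<in> inc E a. strong e} = ?P"
    using card_subset_eq[OF _ P] deg(1) finite_inc by (simp add: sdeg_def)
  obtain f g where fg: "{e \<in> inc E a. \<not> strong e} = {f, g}" "f \<noteq> g"
    using deg(2) unfolding wdeg_def card_2_iff by metis
  then have f: "f \<in> E" "a \<in> ext f" "\<not> strong f" and g: "g \<in> E" "a \<in> ext g" "\<not> strong g"
    by (auto simp: inc_def)
  obtain k s4 y where y: "f = Edge k s4 {a, y}" "a \<noteq> y" "y \<in> V" using edge_at[OF f(1,2)] by metis
  obtain k' s5 z where z: "g = Edge k' s5 {a, z}" "a \<noteq> z" "z \<in> V" using edge_at[OF g(1,2)] by metis
  have f': "f = Edge False s4 {a, y}" and g': "g = Edge False s5 {a, z}" using y z f g by auto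
  have inc: "inc E a = ?P \<union> {Edge False s4 {a, y}, Edge False s5 {a, z}}"
    by (subst inc_split) (simp only: strong_inc fg f' g')
  have nx: "u \<noteq> x" "u \<noteq> b" if "Edge False s {a, u} \<in> E" for s u
  proof -
    show "u \<noteq> x"
    proof
      assume "u = x"
      then have "Edge False s {a, x} \<in> inc E x" using that by (simp add: inc_def)
      then show False using ca ne unfolding incx by (auto simp: doubleton_eq_iff)
    qed
    show "u \<noteq> b"
    proof
      assume "u = b"
      let ?F = "{Edge True s1 {x, a}, Edge True s2 {x, b}, Edge True (s1 = s2) {a, b}, Edge False s {a, b}}"
      have "rho E {x, a, b} \<le> 3 * int (card {x, a, b}) - weight ?F"
        by (rule rho_le[OF finE]) (use e ab that \<open>u = b\<close> in auto)
      then have "rho E {x, a, b} \<le> 2" using ne by (simp add: weight_insert doubleton_eq_iff)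
      then have "{x, a, b} = V" using rho_le2_full[of "{x, a, b}"] e by simp
      then show False using e(7) ca ne by auto
    qed
  qed
  have ne': "y \<noteq> x" "y \<noteq> b" "z \<noteq> x" "z \<noteq> b" "y \<noteq> z \<or> s4 \<noteq> s5"
    using nx f g f' g' fg(2) by auto
  obtain t where by': "Edge True t {b, y} \<in> E"
    using deficient_nbr_two_weak_aux[OF d inc] ne' y z by auto
  have inc': "inc E a = ?P \<union> {Edge False s5 {a, z}, Edge False s4 {a, y}}"
    unfolding inc by auto
  obtain u where bz: "Edge True u {b, z} \<in> E"
    using deficient_nbr_two_weak_aux[OF d inc'] ne' y z by auto
  have cyz: "c \<noteq> y" "c \<noteq> z"
    using deficient_not_adjacent[OF deficient_at_sym[OF d]] by' bz by auto
  show False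
  proof (cases "y = z")
    case False
    let ?T = "{a, x, b, y, z}"
    let ?F = "{Edge True s1 {x, a}, Edge True s2 {x, b}, Edge True (s1 = s2) {a, b}, Edge True t {b, y},
      Edge True u {b, z}, Edge False s4 {a, y}, Edge False s5 {a, z}}"
    have "rho E ?T \<le> 3 * int (card ?T) - weight ?F"
      by (rule rho_le[OF finE]) (use e ab by' bz f g f' g' in auto)
    moreover have "weight ?F = 12"
      using ne ne' y(2) z(2) False by (simp add: weight_insert doubleton_eq_iff)
    moreover have "card ?T = 5" using ne ne' y(2) z(2) False by auto
    ultimately have "?T = V" using rho_le3_full[of ?T] e y z by auto
    then show False using e(7) ca ne cyz by auto
  next
    case True
    then have "s4 \<noteq> s5" using ne' by simp
    let ?T = "{a, x, b, y}"
    let ?F = "{Edge True s1 {x, a}, Edge True s2 {x, b}, Edge True (s1 = s2) {a, b}, Edge True t {b, y},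
      Edge False s4 {a, y}, Edge False s5 {a, y}}"
    have "rho E ?T \<le> 3 * int (card ?T) - weight ?F"
      by (rule rho_le[OF finE]) (use e ab by' f g f' g' True in auto)
    moreover have "weight ?F = 10"
      using ne ne' y(2) \<open>s4 \<noteq> s5\<close> by (simp add: weight_insert doubleton_eq_iff)
    moreover have "card ?T = 4" using ne ne' y(2) by auto
    ultimately have "?T = V" using rho_le2_full[of ?T] e y by auto
    then show False using e(7) ca ne cyz by auto
  qed
qed

section \<open>Vertices with one strong edge and three weak edges\<close>

definition star_at :: "'v \<Rightarrow> bool \<Rightarrow> 'v \<Rightarrow> bool \<Rightarrow> 'v \<Rightarrow> bool \<Rightarrow> 'v \<Rightarrow> bool \<Rightarrow> 'v \<Rightarrow> bool" where
  "star_at v s0 w s1 p s2 q s3 r \<longleftrightarrow> v \<noteq> w \<and> v \<noteq> p \<and> v \<noteq> q \<and> v \<noteq> r \<and>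
     (p \<noteq> q \<or> s1 \<noteq> s2) \<and> (p \<noteq> r \<or> s1 \<noteq> s3) \<and> (q \<noteq> r \<or> s2 \<noteq> s3) \<and>
     inc E v = {Edge True s0 {v, w}, Edge False s1 {v, p}, Edge False s2 {v, q}, Edge False s3 {v, r}}"

lemma star_swap: "star_at v s0 w s1 p s2 q s3 r \<Longrightarrow> star_at v s0 w s2 q s1 p s3 r"
  by (auto simp: star_at_def)

lemma star_rotate: "star_at v s0 w s1 p s2 q s3 r \<Longrightarrow> star_at v s0 w s2 q s3 r s1 p"
  by (auto simp: star_at_def)

lemma star_edges:
  assumes "star_at v s0 w s1 p s2 q s3 r"
  shows "Edge True s0 {v, w} \<in> E" "Edge False s1 {v, p} \<in> E" "Edge False s2 {v, q} \<in> E"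
    "Edge False s3 {v, r} \<in> E" "v \<in> V" "w \<in> V" "p \<in> V" "q \<in> V" "r \<in> V"
proof -
  have "Edge True s0 {v, w} \<in> inc E v" "Edge False s1 {v, p} \<in> inc E v" "Edge False s2 {v, q} \<in> inc E v"
    "Edge False s3 {v, r} \<in> inc E v"
    using assms by (simp_all add: star_at_def)
  then show e: "Edge True s0 {v, w} \<in> E" "Edge False s1 {v, p} \<in> E" "Edge False s2 {v, q} \<in> E"
    "Edge False s3 {v, r} \<in> E"
    by (simp_all add: inc_def)
  show "v \<in> V" "w \<in> V" "p \<in> V" "q \<in> V" "r \<in> V"
    using e edge_ends by blast+
qed

text \<open>The strong edge leaves three colours and each weak edge removes one. As nothing may
  remain, the three forbidden colours are exactly those near the switched colour of
  \<open>w\<close>.\<close>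

lemma star_colors:
  assumes st: "star_at v s0 w s1 p s2 q s3 r" and phi: "sat \<phi> (res E (V - {v}))"
  shows "near (flip (\<not> s1) (\<phi> p)) (flip s0 (\<phi> w)) \<and> flip (\<not> s1) (\<phi> p) \<noteq> flip (\<not> s2) (\<phi> q)"
proof (rule near_cover)
  fix c assume c: "near c (flip s0 (\<phi> w))"
  have ne: "v \<noteq> w" "v \<noteq> p" "v \<noteq> q" "v \<noteq> r"
    and inc: "inc E v = {Edge True s0 {v, w}, Edge False s1 {v, p}, Edge False s2 {v, q}, Edge False s3 {v, r}}"
    using st by (auto simp: star_at_def)
  show "c = flip (\<not> s1) (\<phi> p) \<or> c = flip (\<not> s2) (\<phi> q) \<or> c = flip (\<not> s3) (\<phi> r)"
  proof (rule ccontr)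
    assume "\<not> ?thesis"
    then have "ok (\<phi>(v := c)) (Edge True s0 {v, w})" "ok (\<phi>(v := c)) (Edge False s1 {v, p})"
      "ok (\<phi>(v := c)) (Edge False s2 {v, q})" "ok (\<phi>(v := c)) (Edge False s3 {v, r})"
      using c ne by (simp_all add: ok_pair allow_strong allow_weak opp_flip)
    then show False
      by (intro no_extension[OF phi, of "\<phi>(v := c)"]) (auto simp: inc)
  qed
qed

text \<open>Two weak edges to one vertex have opposite signs and forbid antipodal colours, which
  cannot both be near \<open>w\<close>.\<close>

lemma star_distinct:
  assumes st: "star_at v s0 w s1 p s2 q s3 r"
  shows "p \<noteq> q"
proof
  assume pq: "p = q"
  then have s: "s2 = (\<not> s1)" using st by (auto simp: star_at_def)
  obtain \<phi> where phi: "sat \<phi> (res E (V - {v}))"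
    using res_proper_colorable[of "V - {v}"] star_edges[OF st] by auto
  have "near (flip (\<not> s1) (\<phi> p)) (flip s0 (\<phi> w))" "near (flip s1 (\<phi> p)) (flip s0 (\<phi> w))"
    using star_colors[OF st phi] star_colors[OF star_swap[OF st] phi] s pq by simp_all
  then show False
    using near_opp[of "flip s0 (\<phi> w)" "flip s1 (\<phi> p)"] by (simp add: opp_flip near_commute)
qed

text \<open>A strong edge that puts the colour forbidden by \<open>p\<close> far from
  \<open>w\<close> would make \<open>v\<close> colourable, contrary to
  \<open>star_colors\<close>.\<close>

lemma star_adjacent:
  assumes st: "star_at v s0 w s1 p s2 q s3 r" and pw: "p \<noteq> w"
  shows "Edge True (s0 = s1) {w, p} \<in> E"
proof -
  have ne: "v \<noteq> w" "v \<noteq> p" using st by (auto simp: star_at_def)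
  have "Edge True (\<not> (s0 \<noteq> s1)) {w, p} \<in> E"
  proof (rule gadget_strong[of "{v}" w p "s0 \<noteq> s1"])
    fix \<phi> assume phi: "sat \<phi> (res E (V - {v}))" and "allow True (s0 \<noteq> s1) (\<phi> w) (\<phi> p)"
    then have "near (flip s0 (\<phi> w)) (flip s1 (\<phi> p))" by (simp only: allow_flip allow_near)
    moreover have "near (flip s0 (\<phi> w)) (opp (flip s1 (\<phi> p)))"
      using star_colors[OF st phi] by (simp add: opp_flip near_commute)
    ultimately show False by (simp add: near_opp)
  qed (use star_edges[OF st] ne pw in auto)
  then show ?thesis by simp
qed

text \<open>Otherwise {w, v, q, r} carries weight 9 and is V. Without \<open>q\<close>, weight 6
  remains on three vertices, so \<open>low_vertex\<close> applies to \<open>q\<close> and its weak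
  edge to \<open>v\<close>.\<close>

lemma star_center:
  assumes st: "star_at v s0 w s1 p s2 q s3 r"
  shows "p \<noteq> w"
proof
  assume pw: "p = w"
  have ne: "v \<noteq> w" "v \<noteq> q" "v \<noteq> r" using st by (auto simp: star_at_def)
  have ne': "q \<noteq> w" "r \<noteq> w" "q \<noteq> r"
    using star_distinct[OF st] star_distinct[OF star_rotate[OF st]]
      star_distinct[OF star_rotate[OF star_rotate[OF st]]] pw by auto
  note e = star_edges[OF st]
  have wq: "Edge True (s0 = s2) {w, q} \<in> E"
    by (rule star_adjacent[OF star_swap[OF st] ne'(1)])
  have wr: "Edge True (s0 = s3) {w, r} \<in> E"
    by (rule star_adjacent[OF star_rotate[OF star_rotate[OF st]] ne'(2)])
  let ?T = "{w, v, q, r}"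
  let ?F = "{Edge True s0 {v, w}, Edge True (s0 = s2) {w, q}, Edge True (s0 = s3) {w, r},
    Edge False s1 {v, w}, Edge False s2 {v, q}, Edge False s3 {v, r}}"
  have "rho E ?T \<le> 3 * int (card ?T) - weight ?F"
    by (rule rho_le[OF finE]) (use e wq wr pw in auto)
  moreover have "weight ?F = 9" using ne ne' by (simp add: weight_insert doubleton_eq_iff)
  moreover have "card ?T = 4" using ne ne' by simp
  ultimately have "?T = V" using rho_le3_full[of ?T] e by auto
  then have Vq: "V - {q} = {w, v, r}" using ne ne' by auto
  let ?B = "{Edge True s0 {v, w}, Edge True (s0 = s3) {w, r}, Edge False s1 {v, w}, Edge False s3 {v, r}}"
  have "rho E {w, v, r} \<le> 3 * int (card {w, v, r}) - weight ?B"
    by (rule rho_le[OF finE]) (use e wr pw in auto)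
  moreover have "weight ?B = 6" using ne ne' by (simp add: weight_insert doubleton_eq_iff)
  ultimately have "rho E (V - {q}) \<le> 3" using ne ne' Vq by simp
  moreover have "Edge False s2 {q, v} \<in> E" using e(3) by (simp add: insert_commute)
  ultimately show False using low_vertex[OF e(8)] by blast
qed

lemma star_facts:
  assumes st: "star_at v s0 w s1 p s2 q s3 r"
  shows "v \<noteq> w" "v \<noteq> p" "v \<noteq> q" "v \<noteq> r" "p \<noteq> w" "q \<noteq> w" "r \<noteq> w" "p \<noteq> q" "q \<noteq> r" "p \<noteq> r"
    "Edge True (s0 = s1) {w, p} \<in> E" "Edge True (s0 = s2) {w, q} \<in> E" "Edge True (s0 = s3) {w, r} \<in> E"
proof -
  note st2 = star_rotate[OF st] and st3 = star_rotate[OF star_rotate[OF st]]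
  show "v \<noteq> w" "v \<noteq> p" "v \<noteq> q" "v \<noteq> r" using st by (auto simp: star_at_def)
  show pw: "p \<noteq> w" and qw: "q \<noteq> w" and rw: "r \<noteq> w"
    using star_center[OF st] star_center[OF st2] star_center[OF st3] by auto
  show "p \<noteq> q" "q \<noteq> r" "p \<noteq> r"
    using star_distinct[OF st] star_distinct[OF st2] star_distinct[OF st3] by auto
  show "Edge True (s0 = s1) {w, p} \<in> E" "Edge True (s0 = s2) {w, q} \<in> E" "Edge True (s0 = s3) {w, r} \<in> E"
    using star_adjacent[OF st pw] star_adjacent[OF st2 qw] star_adjacent[OF st3 rw] by auto
qed

lemma star_no_strong:
  assumes st: "star_at v s0 w s1 p s2 q s3 r"
  shows "Edge True t {p, q} \<notin> E"
proof
  assume pq: "Edge True t {p, q} \<in> E"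
  note e = star_edges[OF st] and f = star_facts[OF st]
  let ?T = "{w, v, p, q}"
  let ?F = "{Edge True s0 {v, w}, Edge True (s0 = s1) {w, p}, Edge True (s0 = s2) {w, q}, Edge True t {p, q},
    Edge False s1 {v, p}, Edge False s2 {v, q}}"
  have "rho E ?T \<le> 3 * int (card ?T) - weight ?F"
    by (rule rho_le[OF finE]) (use e f(11,12) pq in auto)
  moreover have "weight ?F = 10" using f(1-10) by (simp add: weight_insert doubleton_eq_iff)
  moreover have "card ?T = 4" using f(1-10) by simp
  ultimately have "?T = V" using rho_le2_full[of ?T] e by auto
  then show False using e(9) f(1-10) by auto
qed

text \<open>The set {w, v, p} would have potential at most 9 - 6 = 3 and be rigid, but the only
  strong edge at \<open>v\<close> goes to \<open>w\<close>.\<close>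

lemma star_no_weak_center:
  assumes st: "star_at v s0 w s1 p s2 q s3 r"
  shows "Edge False t {w, p} \<notin> E"
proof
  assume wp: "Edge False t {w, p} \<in> E"
  note e = star_edges[OF st] and f = star_facts[OF st]
  let ?T = "{w, v, p}"
  let ?F = "{Edge True s0 {v, w}, Edge True (s0 = s1) {w, p}, Edge False s1 {v, p}, Edge False t {w, p}}"
  have "rho E ?T \<le> 3 * int (card ?T) - weight ?F"
    by (rule rho_le[OF finE]) (use e f(11) wp in auto)
  moreover have "weight ?F = 6" using f(1-10) by (simp add: weight_insert doubleton_eq_iff)
  moreover have "card ?T = 3" using f(1-10) by simp
  ultimately have "rho E ?T \<le> 3" by simp
  moreover have "?T \<subset> V" using e(5-8) f(1-10) by blast
  ultimately have "rigid ?T" by (intro rho_le3_rigid) auto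
  then obtain s where "Edge True s {v, p} \<in> E" using f(2) by (auto simp: rigid_def)
  then have "Edge True s {v, p} \<in> inc E v" by (simp add: inc_def)
  then show False using st f(1,2,5) by (auto simp: star_at_def doubleton_eq_iff)
qed

text \<open>Without such an edge, w, p, q can be coloured so that \<open>p\<close> and
  \<open>q\<close> forbid the same colour at \<open>v\<close>. By \<open>star_colors\<close> no
  colouring of V - {v} does this, not even up to an automorphism, so these three vertices can be
  collapsed inside V - {v}. Putting \<open>v\<close> back makes the resulting set too dense.\<close>

lemma star_weak_edge:
  assumes st: "star_at v s0 w s1 p s2 q s3 r"
  shows "\<exists>t. Edge False t {p, q} \<in> E"
proof (rule ccontr)
  assume no: "\<not> ?thesis"
  note e = star_edges[OF st] and f = star_facts[OF st]
  let ?S = "{w, p, q}"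
  let ?F = "{Edge True (s0 = s1) {w, p}, Edge True (s0 = s2) {w, q}}"
  \<comment> \<open>All three vertices get C0 up to the switching seen from \<open>v\<close>. The
    signs of \<open>p\<close> and \<open>q\<close> are complemented because a weak edge forbids the
    antipode.\<close>
  define \<phi> where "\<phi> u = (if u = w then flip s0 C0 else if u = p then flip (\<not> s1) C0 else flip (\<not> s2) C0)" for u
  have res: "res E ?S \<subseteq> ?F"
  proof
    fix g assume "g \<in> res E ?S"
    then have g: "g \<in> E" "ext g \<subseteq> ?S" by (auto simp: res_def)
    obtain k s a b where ab: "g = Edge k s {a, b}" "a \<noteq> b" by (rule loopless_cases[OF llE g(1)])
    then have "{a, b} = {w, p} \<or> {a, b} = {w, q} \<or> {a, b} = {p, q}" using g(2) by auto
    then show "g \<in> ?F"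
    proof (elim disjE)
      assume "{a, b} = {w, p}"
      then have "g = Edge k s {w, p}" using ab by simp
      then show ?thesis
        using g(1) star_no_weak_center[OF st] strong_edge_unique[OF f(11), of s] by (cases k) auto
    next
      assume "{a, b} = {w, q}"
      then have "g = Edge k s {w, q}" using ab by simp
      then show ?thesis
        using g(1) star_no_weak_center[OF star_swap[OF st]] strong_edge_unique[OF f(12), of s] by (cases k) auto
    next
      assume "{a, b} = {p, q}"
      then have "g = Edge k s {p, q}" using ab by simp
      then show ?thesis using g(1) star_no_strong[OF st] no by (cases k) auto
    qed
  qed
  have phi: "sat \<phi> (res E ?S)"
  proof (rule sat_mono[OF _ res])
    have "near (flip s0 C0) (flip ((s0 = t) \<noteq> (\<not> t)) C0)" for t
      by (cases s0; cases t) (simp_all add: flip_def)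
    then show "sat \<phi> ?F"
      using f(5,6,8) f(5,6,8)[symmetric] by (simp add: sat_def ok_pair allow_strong \<phi>_def)
  qed
  have SW: "?S \<subseteq> V - {v}" and WV: "V - {v} \<subseteq> V" and Sne: "?S \<noteq> {}"
    using e f(1-10) by auto
  have cS: "card ?S = 3" using f(5,6,8) by simp
  have "base (flip s C0) = C0" for s by (cases s) (simp_all add: base_def flip_def)
  then have "(\<lambda>v. base (\<phi> v)) ` ?S \<subseteq> {C0}" by (auto simp: \<phi>_def)
  from card_mono[OF _ this] have "card ((\<lambda>v. base (\<phi> v)) ` ?S) \<le> 1" by simp
  then have small: "card ((\<lambda>v. base (\<phi> v)) ` ?S) < card ?S \<or> card ((\<lambda>v. base (\<phi> v)) ` ?S) < card (res E ?S)"
    using cS by simp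
  have noext: False if "col_aut g" "sat \<theta> (res E (V - {v}))" "\<And>u. u \<in> ?S \<Longrightarrow> \<theta> u = g (\<phi> u)" for \<theta> g
  proof -
    have "\<theta> p = flip (\<not> s1) (g C0)" "\<theta> q = flip (\<not> s2) (g C0)"
      using that(3)[of p] that(3)[of q] f(5,6,8) f(8)[symmetric] by (simp_all add: \<phi>_def col_aut_flip[OF that(1)])
    then show False using star_colors[OF st that(2)] by simp
  qed
  obtain S' where S': "?S \<subset> S'" "S' \<subseteq> V - {v}" and alt: "rho E S' \<le> rho E ?S - 2 \<or>
    rho E S' \<le> rho E ?S - 1 \<and> (\<exists>z u y s t. z \<notin> ?S \<and> S' = insert z ?S \<and> u \<in> ?S \<and> y \<in> ?S \<and> u \<noteq> y \<and>
      Edge True s {z, u} \<in> E \<and> Edge True t {z, y} \<in> E)"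
    by (rule quotient_step[OF SW WV Sne phi noext small])
  have "rho E ?S \<le> 3 * int (card ?S) - weight ?F"
    by (rule rho_le[OF finE]) (use f in auto)
  moreover have "weight ?F = 4" using f(5,6,8) by (simp add: weight_insert doubleton_eq_iff)
  ultimately have rS: "rho E ?S \<le> 5" using cS by simp
  let ?T = "insert v S'"
  have TV: "?T \<subseteq> V" using S' e(5) by auto
  have finT: "finite ?T" by (rule finite_subset[OF TV finV])
  have vS': "v \<notin> S'" using S' by auto
  then have TS: "?T - S' = {v}" by auto
  let ?G = "{Edge True s0 {v, w}, Edge False s1 {v, p}, Edge False s2 {v, q}}"
  have wG: "weight ?G = 4" using f(1-10) by (simp add: weight_insert doubleton_eq_iff)
  have "rho E ?T \<le> rho E S' + 3 * int (card (?T - S')) - weight ?G"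
    by (rule rho_extend[OF finE finT]) (use e S' vS' in auto)
  then have rT: "rho E ?T \<le> rho E S' - 1" unfolding TS wG by simp
  \<comment> \<open>Putting \<open>v\<close> back changes the potential by 3 - 4 = -1. After a drop
    by 2 it is at most 5 - 2 - 1 = 2, so the set is V and the edge to \<open>r\<close> lowers it to
    1. After a drop by 1 it is at most 3 on five vertices, so again the set is V and the new vertex
    is \<open>r\<close>, strongly adjacent to \<open>p\<close> or \<open>q\<close>.\<close>
  show False
    using alt
  proof
    assume "rho E S' \<le> rho E ?S - 2"
    then have "rho E ?T \<le> 2" using rS rT by linarith
    then have "?T = V" using rho_le2_full[OF TV] by simp
    then have rS': "r \<in> S'" using e(9) f(4) by auto
    let ?H = "insert (Edge False s3 {v, r}) ?G"
    have wH: "weight ?H = 5" using f(1-10) by (simp add: weight_insert doubleton_eq_iff)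
    have "rho E ?T \<le> rho E S' + 3 * int (card (?T - S')) - weight ?H"
      by (rule rho_extend[OF finE finT]) (use e S' vS' rS' in auto)
    then have "rho E ?T \<le> 1" using \<open>rho E S' \<le> _\<close> rS unfolding TS wH by simp
    then show False using rho_ge2[OF TV] by simp
  next
    assume "rho E S' \<le> rho E ?S - 1 \<and> (\<exists>z u y s t. z \<notin> ?S \<and> S' = insert z ?S \<and> u \<in> ?S \<and> y \<in> ?S \<and> u \<noteq> y \<and>
      Edge True s {z, u} \<in> E \<and> Edge True t {z, y} \<in> E)"
    then obtain z u y s t where z: "z \<notin> ?S" "S' = insert z ?S" "u \<in> ?S" "y \<in> ?S" "u \<noteq> y"
      "Edge True s {z, u} \<in> E" "Edge True t {z, y} \<in> E" and le: "rho E S' \<le> rho E ?S - 1"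
      by (elim conjE exE)
    have "card S' = 4" using z(1,2) cS by simp
    then have "card ?T = 5" using vS' finT by simp
    then have "?T = V" using rho_le3_full[OF TV] rT le rS by simp
    then have "r = z" using e(9) f(1-10) z(2) by auto
    then have "\<exists>s. Edge True s {r, p} \<in> E \<or> Edge True s {r, q} \<in> E"
      using z(3-7) by auto
    then show False
      using star_no_strong[OF star_rotate[OF st]] star_no_strong[OF star_rotate[OF star_rotate[OF st]]]
      by (auto simp: insert_commute)
  qed
qed

text \<open>The facts collected give four strong and six weak edges on five vertices: 15 - 14 = 1 is
  below the minimum 2.\<close>

lemma no_star:
  assumes st: "star_at v s0 w s1 p s2 q s3 r"
  shows False
proof -
  note e = star_edges[OF st] and f = star_facts[OF st]
  obtain t1 t2 t3 where t: "Edge False t1 {p, q} \<in> E" "Edge False t2 {q, r} \<in> E" "Edge False t3 {r, p} \<in> E"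
    using star_weak_edge[OF st] star_weak_edge[OF star_rotate[OF st]]
      star_weak_edge[OF star_rotate[OF star_rotate[OF st]]] by auto
  let ?T = "{v, w, p, q, r}"
  let ?F = "{Edge True s0 {v, w}, Edge True (s0 = s1) {w, p}, Edge True (s0 = s2) {w, q}, Edge True (s0 = s3) {w, r},
    Edge False s1 {v, p}, Edge False s2 {v, q}, Edge False s3 {v, r},
    Edge False t1 {p, q}, Edge False t2 {q, r}, Edge False t3 {r, p}}"
  have "rho E ?T \<le> 3 * int (card ?T) - weight ?F"
    by (rule rho_le[OF finE]) (use e f t in auto)
  moreover have "weight ?F = 14" using f(1-10) by (simp add: weight_insert doubleton_eq_iff)
  moreover have "card ?T = 5" using f(1-10) by simp
  moreover have "2 \<le> rho E ?T" using rho_ge2[of ?T] e by simp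
  ultimately show False by simp
qed

lemma not_star_degrees:
  assumes "sdeg v = 1" "wdeg v = 3"
  shows False
proof -
  from assms(1) obtain e0 where e0: "{e \<in> inc E v. strong e} = {e0}"
    unfolding sdeg_def by (rule card_1_singletonE)
  from assms(2) obtain e1 e2 e3 where e: "{e \<in> inc E v. \<not> strong e} = {e1, e2, e3}"
    "e1 \<noteq> e2" "e2 \<noteq> e3" "e1 \<noteq> e3"
    unfolding wdeg_def card_3_iff by metis
  have s0: "e0 \<in> E" "v \<in> ext e0" "strong e0" using e0 by (auto simp: inc_def)
  have s1: "e1 \<in> E" "v \<in> ext e1" "\<not> strong e1" and s2: "e2 \<in> E" "v \<in> ext e2" "\<not> strong e2"
    and s3: "e3 \<in> E" "v \<in> ext e3" "\<not> strong e3" using e(1) by (auto simp: inc_def)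
  obtain k0 t0 w where w: "e0 = Edge k0 t0 {v, w}" "v \<noteq> w" using edge_at[OF s0(1,2)] by metis
  obtain k1 t1 p where p: "e1 = Edge k1 t1 {v, p}" "v \<noteq> p" using edge_at[OF s1(1,2)] by metis
  obtain k2 t2 q where q: "e2 = Edge k2 t2 {v, q}" "v \<noteq> q" using edge_at[OF s2(1,2)] by metis
  obtain k3 t3 r where r: "e3 = Edge k3 t3 {v, r}" "v \<noteq> r" using edge_at[OF s3(1,2)] by metis
  have k: "k0" "\<not> k1" "\<not> k2" "\<not> k3" using w p q r s0 s1 s2 s3 by auto
  have "inc E v = {e0} \<union> {e1, e2, e3}" using inc_split[of v] unfolding e0 e(1) .
  then have "inc E v = {e0, e1, e2, e3}" by (simp only: Un_insert_left Un_empty_left)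
  then have "star_at v t0 w t1 p t2 q t3 r"
    unfolding star_at_def using w p q r k e(2-4) by auto
  then show False by (rule no_star)
qed

section \<open>Discharging\<close>

lemma sum_weight_inc: "(\<Sum>v\<in>V. weight (inc E v)) = 2 * weight E"
proof -
  have "(\<Sum>v\<in>V. weight (inc E v)) = (\<Sum>v\<in>V. \<Sum>e\<in>E. if v \<in> ext e then wt e else 0)"
    unfolding weight_def inc_def by (simp add: sum.inter_filter[OF finE])
  also have "\<dots> = (\<Sum>e\<in>E. \<Sum>v\<in>V. if v \<in> ext e then wt e else 0)" by (rule sum.swap)
  also have "\<dots> = (\<Sum>e\<in>E. 2 * wt e)"
  proof (rule sum.cong)
    fix e assume e: "e \<in> E"
    then have "V \<inter> {v. v \<in> ext e} = ext e" by (auto simp: vset_def)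
    moreover have "card (ext e) = 2" using llE e by (auto simp: loopless_def)
    ultimately show "(\<Sum>v\<in>V. if v \<in> ext e then wt e else 0) = 2 * wt e"
      by (simp add: sum.If_cases[OF finV])
  qed simp
  finally show ?thesis by (simp add: weight_def sum_distrib_left)
qed

definition deficient :: "'v set" where
  "deficient = {v \<in> V. sdeg v = 2 \<and> wdeg v = 1}"

definition boundary :: "'v cedge set" where
  "boundary = {e \<in> E. strong e \<and> ext e \<inter> deficient \<noteq> {}}"

lemma deficient_nbr_degrees:
  assumes d: "deficient_at x s1 a s2 b s3 c"
  shows "a \<notin> deficient" "\<not> (sdeg a = 2 \<and> wdeg a = 2)" "\<not> (sdeg a = 3 \<and> wdeg a = 0)"
  using deficient_nbr_not_deficient[OF d] deficient_nbr_two_weak[OF d] deficient_nbr_strong_three[OF d]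
  by (auto simp: deficient_def)

lemma boundary_cases:
  assumes "e \<in> boundary" "v \<in> ext e" "v \<notin> deficient"
  obtains x s1 s2 b s3 c where "deficient_at x s1 v s2 b s3 c" "x \<in> deficient" "e = Edge True s1 {x, v}"
proof -
  from assms obtain x where x: "x \<in> ext e" "x \<in> deficient" "e \<in> E" "strong e" by (auto simp: boundary_def)
  then have "sdeg x = 2" "wdeg x = 1" by (auto simp: deficient_def)
  then obtain s1 a s2 b s3 c where d: "deficient_at x s1 a s2 b s3 c" by (rule deficient_at_ex)
  have "e \<in> inc E x" using x by (simp add: inc_def)
  then have "e \<in> {Edge True s1 {x, a}, Edge True s2 {x, b}, Edge False s3 {x, c}}"
    using d unfolding deficient_at_def by blast
  then have "e = Edge True s1 {x, a} \<or> e = Edge True s2 {x, b}"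
    using x(4) by auto
  then show ?thesis
  proof
    assume e: "e = Edge True s1 {x, a}"
    then have "v = a" using assms x by auto
    then show ?thesis using that[of x s1 s2 b s3 c] d e x(2) by simp
  next
    assume e: "e = Edge True s2 {x, b}"
    then have "v = b" using assms x by auto
    then show ?thesis using that[of x s2 s1 a s3 c] deficient_at_sym[OF d] e x(2) by simp
  qed
qed

text \<open>Strong neighbours of deficient vertices are not deficient, so each boundary edge has a
  well-defined payer and receiver.\<close>

lemma boundary_ends:
  assumes "e \<in> boundary"
  shows "card (ext e \<inter> deficient) = 1 \<and> card (ext e \<inter> (V - deficient)) = 1"
proof -
  from assms obtain x where x: "x \<in> ext e" "x \<in> deficient" "e \<in> E" "strong e" by (auto simp: boundary_def)
  then have "sdeg x = 2" "wdeg x = 1" by (auto simp: deficient_def)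
  then obtain s1 a s2 b s3 c where d: "deficient_at x s1 a s2 b s3 c" by (rule deficient_at_ex)
  have ab: "a \<notin> deficient" "b \<notin> deficient" "a \<in> V" "b \<in> V"
    using deficient_nbr_degrees[OF d] deficient_nbr_degrees[OF deficient_at_sym[OF d]] deficient_edges[OF d] by auto
  have "e \<in> inc E x" using x by (simp add: inc_def)
  then have "e \<in> {Edge True s1 {x, a}, Edge True s2 {x, b}, Edge False s3 {x, c}}"
    using d unfolding deficient_at_def by blast
  then have "ext e = {x, a} \<or> ext e = {x, b}" using x(4) by auto
  then obtain u where u: "ext e = {x, u}" "u \<notin> deficient" "u \<in> V" using ab by auto
  then have "ext e \<inter> deficient = {x}" "ext e \<inter> (V - deficient) = {u}" using x(2) by auto
  then show ?thesis by simp
qed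

text \<open>A deficient vertex receives charge 1 along each of its two strong edges.\<close>

lemma charge:
  assumes v: "v \<in> V - deficient"
  shows "card {e \<in> boundary. v \<in> ext e} + 12 \<le> 4 * sdeg v + 2 * wdeg v"
proof (cases "{e \<in> boundary. v \<in> ext e} = {}")
  \<comment> \<open>The charge is twice the incident weight, so 12 stands for degree 3 with weak
    edges counted half; a deficient vertex starts with 10.\<close>
  case True
  have "6 \<le> 3 * sdeg v + wdeg v" using degree_bound v by simp
  moreover have "\<not> (sdeg v = 2 \<and> wdeg v = 0)" using not_two_strong v by blast
  moreover have "\<not> (sdeg v = 2 \<and> wdeg v = 1)" using v by (auto simp: deficient_def)
  moreover have "\<not> (sdeg v = 1 \<and> wdeg v = 3)" using not_star_degrees by blast
  ultimately have "12 \<le> 4 * sdeg v + 2 * wdeg v" by presburger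
  then show ?thesis unfolding True by simp
next
  case False
  then obtain e where e: "e \<in> boundary" "v \<in> ext e" by auto
  then obtain x s1 s2 b s3 c where d: "deficient_at x s1 v s2 b s3 c" "x \<in> deficient"
    using boundary_cases v by (metis DiffD2)
  note deg = deficient_nbr_degrees[OF d(1)]
  have b: "b \<notin> deficient" using deficient_nbr_degrees[OF deficient_at_sym[OF d(1)]] by simp
  have ne: "x \<noteq> v" "x \<noteq> b" "v \<noteq> b" using d(1) by (auto simp: deficient_at_def)
  \<comment> \<open>The third edge of the triangle joins two vertices that are not deficient, so
    \<open>v\<close> pays along at most \<open>sdeg v\<close> - 1 edges. This suffices for four
    strong edges, for three with a weak one, and for two with three weak ones; the other cases are
    excluded.\<close>
  let ?f = "Edge True (s1 = s2) {v, b}" and ?B = "{e \<in> boundary. v \<in> ext e}"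
  have f: "?f \<in> {e \<in> inc E v. strong e}" using deficient_triangle[OF d(1)] by (simp add: inc_def)
  have "?f \<notin> ?B" using b v by (auto simp: boundary_def)
  moreover have "?B \<subseteq> {e \<in> inc E v. strong e}" by (auto simp: boundary_def inc_def)
  ultimately have "?B \<subset> {e \<in> inc E v. strong e}" using f by blast
  then have lt: "card ?B < sdeg v"
    unfolding sdeg_def by (intro psubset_card_mono) (auto simp: finite_inc)
  have "{Edge True s1 {x, v}, ?f} \<subseteq> {e \<in> inc E v. strong e}"
    using f deficient_edges[OF d(1)] by (simp add: inc_def)
  from card_mono[OF _ this] have "2 \<le> sdeg v"
    using ne finite_inc by (simp add: sdeg_def doubleton_eq_iff)
  moreover have "\<not> (sdeg v = 2 \<and> wdeg v = 0)" using not_two_strong v by blast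
  moreover have "\<not> (sdeg v = 2 \<and> wdeg v = 1)" using v by (auto simp: deficient_def)
  moreover have "t < s \<Longrightarrow> 2 \<le> s \<Longrightarrow> \<not> (s = 2 \<and> w = 0) \<Longrightarrow> \<not> (s = 2 \<and> w = 1) \<Longrightarrow>
    \<not> (s = 2 \<and> w = 2) \<Longrightarrow> \<not> (s = 3 \<and> w = 0) \<Longrightarrow> t + 12 \<le> 4 * s + 2 * w" for s t w :: nat
    by presburger
  ultimately show ?thesis using deg(2,3) lt by blast
qed

theorem no_counterexample: False
proof -
  let ?X = deficient and ?c = "\<lambda>v. 4 * sdeg v + 2 * wdeg v"
  have XV: "?X \<subseteq> V" by (auto simp: deficient_def)
  have fin: "finite ?X" "finite (V - ?X)" "finite boundary"
    using XV finV finite_subset finE by (auto simp: boundary_def)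
  have two: "card {e \<in> boundary. x \<in> ext e} = 2" if "x \<in> ?X" for x
  proof -
    have "{e \<in> boundary. x \<in> ext e} = {e \<in> inc E x. strong e}"
      using that by (auto simp: boundary_def inc_def)
    then show ?thesis using that by (simp add: deficient_def sdeg_def)
  qed
  have "(\<Sum>v\<in>?X. card {e \<in> boundary. v \<in> ext e}) = card boundary"
    using boundary_ends by (simp add: sum_card_incident fin)
  then have cX: "card boundary = 2 * card ?X" using two by simp
  have "(\<Sum>v\<in>V - ?X. card {e \<in> boundary. v \<in> ext e}) = card boundary"
    using boundary_ends by (simp add: sum_card_incident fin)
  then have "2 * card ?X + 12 * card (V - ?X) = (\<Sum>v\<in>V - ?X. card {e \<in> boundary. v \<in> ext e} + 12)"
    using cX by (simp only: sum.distrib) simp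
  also have "\<dots> \<le> (\<Sum>v\<in>V - ?X. ?c v)" by (rule sum_mono) (rule charge)
  finally have 1: "2 * card ?X + 12 * card (V - ?X) \<le> (\<Sum>v\<in>V - ?X. ?c v)" .
  have 2: "(\<Sum>v\<in>?X. ?c v) = 10 * card ?X" by (simp add: deficient_def)
  have "(\<Sum>v\<in>V. ?c v) = (\<Sum>v\<in>V - ?X. ?c v) + (\<Sum>v\<in>?X. ?c v)"
    by (rule sum.subset_diff[OF XV finV])
  then have "12 * card V \<le> (\<Sum>v\<in>V. ?c v)"
    using 1 2 card_Diff_subset[OF fin(1) XV] card_mono[OF finV XV] by simp
  moreover have "int (\<Sum>v\<in>V. ?c v) = 2 * (\<Sum>v\<in>V. weight (inc E v))"
    unfolding weight_inc sum_distrib_left by simp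
  ultimately have "12 * int (card V) \<le> 4 * weight E"
    using sum_weight_inc by linarith
  then show False using rho_ge by (simp add: rho_vset)
qed

end

theorem critical_rho_le_1:
  assumes "critical E" "\<not> is_digon E"
  shows "rho E (vset E) \<le> 1"
proof -
  have "wf (measures [\<lambda>E :: 'a cedge set. card (vset E), card])" by (rule wf_measures)
  then show ?thesis
    using assms
  proof (induction E rule: wf_induct_rule)
    case (less E)
    show ?case
    proof (rule ccontr)
      assume "\<not> ?case"
      then interpret counterexample E
        using less by unfold_locales (auto simp: not_le)
      show False by (rule no_counterexample)
    qed
  qed
qed

section \<open>Circular colourings\<close>

fun col_int :: "col \<Rightarrow> int" where
  "col_int C0 = 0" | "col_int C1 = 1" | "col_int C2 = 2" | "col_int C3 = 3" | "col_int C4 = 4" | "col_int C5 = 5"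

text \<open>The default sends 6 to C0: rounding down six times a number of the closed unit interval
  can give 6.\<close>

definition int_col :: "int \<Rightarrow> col" where
  "int_col k = (if k = 1 then C1 else if k = 2 then C2 else if k = 3 then C3 else if k = 4 then C4
     else if k = 5 then C5 else C0)"

text \<open>Edge names are forgotten, so parallel edges of equal sign collapse; for critical graphs
  this is shown not to happen.\<close>

definition to_edge :: "('v, 'e) signed_graph \<Rightarrow> 'e \<Rightarrow> 'v cedge" where
  "to_edge G e = Edge True (signature G e = Positive) (set_uprod (ends G e))"

lemma near_col_int: "near c d \<longleftrightarrow> \<bar>col_int c - col_int d\<bar> \<le> 1 \<or> 5 \<le> \<bar>col_int c - col_int d\<bar>"
  by (cases c; cases d; simp add: near_def)

lemma near_int_col:
  assumes "k \<in> {0..6}" "l \<in> {0..6}"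
  shows "near (int_col k) (int_col l) \<longleftrightarrow> \<bar>k - l\<bar> \<le> 1 \<or> 5 \<le> \<bar>k - l\<bar>"
proof -
  have "k = 0 \<or> k = 1 \<or> k = 2 \<or> k = 3 \<or> k = 4 \<or> k = 5 \<or> k = 6"
    "l = 0 \<or> l = 1 \<or> l = 2 \<or> l = 3 \<or> l = 4 \<or> l = 5 \<or> l = 6"
    using assms by auto
  then show ?thesis by (elim disjE) (simp_all add: int_col_def near_def)
qed

lemma set_uprod_eq: "set_uprod x = {u, v} \<longleftrightarrow> x = Upair u v"
  by (cases x) (auto simp: doubleton_eq_iff)

lemma allow_sign: "allow True (sg = Positive) c d \<longleftrightarrow> (if sg = Positive then \<not> near c d else near c d)"
  by (simp add: allow_far allow_near)

lemma ok_to_edge: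
  "ok \<phi> (to_edge G e) \<longleftrightarrow> (\<forall>u v. ends G e = Upair u v \<longrightarrow> u \<noteq> v \<longrightarrow>
     (if signature G e = Positive then \<not> near (\<phi> u) (\<phi> v) else near (\<phi> u) (\<phi> v)))"
  by (cases "ends G e") (auto simp: ok_def to_edge_def allow_sign near_commute)

text \<open>The six colours give a circular colouring with p = 6 and q = 2. On loops
  \<open>ok\<close> is void, which is right for negative loops, while positive ones are excluded by
  hypothesis.\<close>

lemma colorable_imp_chi_le_3:
  assumes "\<not> has_positive_loop G" "colorable (to_edge G ` edges G)"
  shows "circular_chromatic_number G \<le> 3"
proof -
  from assms(2) obtain \<phi> where phi: "\<And>e. e \<in> edges G \<Longrightarrow> ok \<phi> (to_edge G e)"
    by (auto simp: colorable_def sat_def)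
  have cc: "circular_coloring 6 2 G (\<lambda>v. col_int (\<phi> v))"
    unfolding circular_coloring_def
  proof (intro conjI ballI allI impI)
    fix v show "col_int (\<phi> v) \<in> {0..6 - 1}" by (cases "\<phi> v") auto
  next
    fix e u v assume e: "e \<in> edges G" "ends G e = Upair u v" "signature G e = Positive"
    then have "u \<noteq> v" using assms(1) by (auto simp: has_positive_loop_def)
    then have "\<not> near (\<phi> u) (\<phi> v)" using phi[OF e(1)] e by (simp add: ok_to_edge)
    then show "2 \<le> \<bar>col_int (\<phi> u) - col_int (\<phi> v)\<bar>" "\<bar>col_int (\<phi> u) - col_int (\<phi> v)\<bar> \<le> 6 - 2"
      by (simp_all add: near_col_int)
  next
    fix e u v assume e: "e \<in> edges G" "ends G e = Upair u v" "signature G e = Negative"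
    then have "near (\<phi> u) (\<phi> v)" using phi[OF e(1)] e by (cases "u = v") (simp_all add: ok_to_edge)
    then show "\<bar>col_int (\<phi> u) - col_int (\<phi> v)\<bar> \<le> 6 div 2 - 2 \<or> 6 div 2 + 2 \<le> \<bar>col_int (\<phi> u) - col_int (\<phi> v)\<bar>"
      by (simp add: near_col_int)
  qed
  have "ereal (real_of_int 6 / real_of_int 2) \<in> {ereal (real_of_int p / real_of_int q) | p q.
            0 < p \<and> 0 < q \<and> 2 * q \<le> p \<and> even p \<and> (\<exists>\<phi>. circular_coloring p q G \<phi>)}"
    by (simp only: mem_Collect_eq, rule exI[of _ 6], rule exI[of _ 2]) (use cc in auto)
  then have "circular_chromatic_number G \<le> ereal (real_of_int 6 / real_of_int 2)"
    unfolding circular_chromatic_number_def by (rule Inf_lower)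
  then show ?thesis by simp
qed

section \<open>Compactness and rounding of colourings on the circle\<close>

lemma bounded_family_subseq:
  fixes X :: "nat \<Rightarrow> 'a \<Rightarrow> real"
  assumes "finite A" "\<And>n v. \<bar>X n v\<bar> \<le> K"
  shows "\<exists>r :: nat \<Rightarrow> nat. strict_mono r \<and> (\<forall>v\<in>A. convergent (\<lambda>n. X (r n) v))"
  using assms(1)
proof induction
  case empty
  then show ?case by (intro exI[of _ id]) (simp add: strict_mono_def)
next
  case (insert a A)
  then obtain r :: "nat \<Rightarrow> nat" where r: "strict_mono r" "\<forall>v\<in>A. convergent (\<lambda>n. X (r n) v)" by auto
  \<comment> \<open>Refining by a monotone subsequence makes one more coordinate converge and
    preserves the convergence of the others.\<close>
  obtain s :: "nat \<Rightarrow> nat" where s: "strict_mono s" "monoseq (\<lambda>n. X (r (s n)) a)"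
    using seq_monosub[of "\<lambda>n. X (r n) a"] by auto
  have "Bseq (\<lambda>n. X (r (s n)) a)" by (rule BseqI'[of _ K]) (use assms(2) in simp)
  then have "convergent (\<lambda>n. X (r (s n)) a)" using s(2) by (rule Bseq_monoseq_convergent)
  moreover have "convergent (\<lambda>n. X (r (s n)) v)" if "v \<in> A" for v
    using convergent_subseq_convergent[of "\<lambda>n. X (r n) v" s] r(2) s(1) that by (simp add: o_def)
  moreover have "strict_mono (r \<circ> s)" using r(1) s(1) by (rule strict_mono_o)
  ultimately have "strict_mono (r \<circ> s) \<and> (\<forall>v\<in>insert a A. convergent (\<lambda>n. X ((r \<circ> s) n) v))"
    by simp
  then show ?case by blast
qed

text \<open>Measuring how far \<open>\<bar>f u - f v\<bar>\<close> is from 1/2 makes both edge conditions closed.\<close>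

definition circle_coloring :: "real \<Rightarrow> ('v, 'e) signed_graph \<Rightarrow> ('v \<Rightarrow> real) \<Rightarrow> bool" where
  "circle_coloring t G f \<longleftrightarrow> (\<forall>v. 0 \<le> f v \<and> f v \<le> 1) \<and>
     (\<forall>e\<in>edges G. \<forall>u v. ends G e = Upair u v \<longrightarrow>
       (if signature G e = Positive then \<bar>\<bar>f u - f v\<bar> - 1/2\<bar> \<le> 1/2 - t else t \<le> \<bar>\<bar>f u - f v\<bar> - 1/2\<bar>))"

text \<open>Dividing by p scales the circle to length 1, where both edge conditions depend only on
  q/p and become weaker as \<open>t\<close> decreases.\<close>

lemma circle_coloring_of_int:
  assumes G: "finite_signed_graph G" and c: "circular_coloring p q G \<phi>"
    and pq: "0 < p" "0 < q" "even p" and t: "t \<le> real_of_int q / real_of_int p"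
  shows "circle_coloring t G (\<lambda>v. if v \<in> verts G then real_of_int (\<phi> v) / real_of_int p else 0)"
    (is "circle_coloring t G ?f")
  unfolding circle_coloring_def
proof (intro conjI allI ballI impI)
  have range: "0 \<le> \<phi> v" "\<phi> v \<le> p" if "v \<in> verts G" for v
    using c that by (auto simp: circular_coloring_def)
  show "0 \<le> ?f v" "?f v \<le> 1" for v using range[of v] pq by auto
  fix e u v assume e: "e \<in> edges G" "ends G e = Upair u v"
  then have uv: "u \<in> verts G" "v \<in> verts G" using G by (auto simp: finite_signed_graph_def)
  define d where "d = \<bar>\<phi> u - \<phi> v\<bar>"
  have d: "\<bar>?f u - ?f v\<bar> = real_of_int d / real_of_int p"
    using uv pq by (simp add: d_def diff_divide_distrib[symmetric])
  obtain h where h: "p = 2 * h" using pq(3) by auto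
  show "if signature G e = Positive then \<bar>\<bar>?f u - ?f v\<bar> - 1/2\<bar> \<le> 1/2 - t else t \<le> \<bar>\<bar>?f u - ?f v\<bar> - 1/2\<bar>"
  proof (cases "signature G e")
    case Positive
    then have "q \<le> d" "d \<le> p - q" using c e by (auto simp: circular_coloring_def d_def)
    then have "real_of_int q / real_of_int p \<le> real_of_int d / real_of_int p"
      "real_of_int d / real_of_int p \<le> 1 - real_of_int q / real_of_int p"
      using pq by (simp_all add: divide_simps)
    then show ?thesis unfolding d using Positive t by (simp add: abs_le_iff)
  next
    case Negative
    then have "d \<le> h - q \<or> h + q \<le> d" using c e h by (auto simp: circular_coloring_def d_def)
    then have "real_of_int d / real_of_int p \<le> 1/2 - real_of_int q / real_of_int p \<or>
      1/2 + real_of_int q / real_of_int p \<le> real_of_int d / real_of_int p"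
      using pq h by (auto simp: divide_simps)
    then show ?thesis unfolding d using Negative t by auto
  qed
qed

text \<open>On the circle of length 6 the bounds on differences are the integers 1, 2, 4 and 5, and
  integer bounds survive rounding down.\<close>

lemma colorable_of_circle_coloring:
  assumes "circle_coloring (1/3) G f"
  shows "colorable (to_edge G ` edges G)"
proof -
  define \<phi> where "\<phi> v = int_col \<lfloor>6 * f v\<rfloor>" for v
  have range: "\<lfloor>6 * f v\<rfloor> \<in> {0..6}" for v
  proof -
    have "0 \<le> 6 * f v" "6 * f v \<le> 6" using assms by (auto simp: circle_coloring_def)
    then show ?thesis by (simp add: floor_le_iff)
  qed
  have "ok \<phi> (to_edge G e)" if "e \<in> edges G" for e
    unfolding ok_to_edge
  proof (intro allI impI)
    fix u v assume uv: "ends G e = Upair u v"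
    have c: "if signature G e = Positive then \<bar>\<bar>f u - f v\<bar> - 1/2\<bar> \<le> 1/6 else 1/3 \<le> \<bar>\<bar>f u - f v\<bar> - 1/2\<bar>"
      using assms that uv by (force simp: circle_coloring_def)
    show "if signature G e = Positive then \<not> near (\<phi> u) (\<phi> v) else near (\<phi> u) (\<phi> v)"
    proof (cases "signature G e = Positive")
      case True
      then have "2 \<le> \<bar>\<lfloor>6 * f u\<rfloor> - \<lfloor>6 * f v\<rfloor>\<bar>" "\<bar>\<lfloor>6 * f u\<rfloor> - \<lfloor>6 * f v\<rfloor>\<bar> \<le> 4"
        using c by (simp_all add: abs_if split: if_splits) linarith+
      then show ?thesis using True range by (simp add: \<phi>_def near_int_col)
    next
      case False
      then have "\<bar>\<lfloor>6 * f u\<rfloor> - \<lfloor>6 * f v\<rfloor>\<bar> \<le> 1 \<or> 5 \<le> \<bar>\<lfloor>6 * f u\<rfloor> - \<lfloor>6 * f v\<rfloor>\<bar>"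
        using c by (simp add: abs_if split: if_splits) linarith+
      then show ?thesis using False range by (simp add: \<phi>_def near_int_col)
    qed
  qed
  then show ?thesis by (auto simp: colorable_def sat_def)
qed

text \<open>Colourings whose ratios tend to 3 yield one of ratio 3 by compactness, so attainment of the
  infimum need not be known.\<close>

lemma chi_le_3_imp_colorable:
  assumes G: "finite_signed_graph G" and chi: "circular_chromatic_number G \<le> 3"
  shows "colorable (to_edge G ` edges G)"
proof -
  \<comment> \<open>A colouring with p/q below 3 + 1/(n+1) has q/p at least
    \<open>t n\<close>.\<close>
  define t where "t n = 1 / (3 + 1 / real (Suc n))" for n
  have "\<exists>f. circle_coloring (t n) G f \<and> (\<forall>v. v \<notin> verts G \<longrightarrow> f v = 0)" for n
  proof -
    have "circular_chromatic_number G < ereal (3 + 1 / real (Suc n))"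
      using chi by (rule order.strict_trans1) simp
    then obtain p q \<phi> where pq: "0 < q" "2 * q \<le> p" "even p" "circular_coloring p q G \<phi>"
      and lt: "real_of_int p / real_of_int q < 3 + 1 / real (Suc n)"
      unfolding circular_chromatic_number_def Inf_less_iff by auto
    have p: "0 < p" using pq(1,2) by simp
    have pos: "0 < real_of_int p / real_of_int q" using pq(1) p by simp
    have "t n \<le> real_of_int q / real_of_int p"
      using le_imp_inverse_le[OF less_imp_le[OF lt] pos] by (simp add: t_def inverse_eq_divide)
    from circle_coloring_of_int[OF G pq(4) p pq(1,3) this] show ?thesis by (intro exI conjI) auto
  qed
  then obtain X where X: "\<And>n. circle_coloring (t n) G (X n)" "\<And>n v. v \<notin> verts G \<Longrightarrow> X n v = 0" by metis
  have "\<bar>X n v\<bar> \<le> 1" for n v using X(1)[of n] by (auto simp: circle_coloring_def)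
  then obtain r :: "nat \<Rightarrow> nat" where r: "strict_mono r" "\<forall>v\<in>verts G. convergent (\<lambda>n. X (r n) v)"
    using bounded_family_subseq[of "verts G" X 1] G by (auto simp: finite_signed_graph_def)
  define f where "f v = lim (\<lambda>n. X (r n) v)" for v
  have f: "(\<lambda>n. X (r n) v) \<longlonglongrightarrow> f v" for v
  proof (cases "v \<in> verts G")
    case True
    then show ?thesis using r(2) by (simp add: f_def convergent_LIMSEQ_iff)
  next
    case False
    then show ?thesis using X(2) by (simp add: f_def)
  qed
  have "t \<longlonglongrightarrow> 1 / (3 + 0)"
    unfolding t_def by (intro tendsto_intros LIMSEQ_Suc[OF lim_1_over_n, unfolded] ) auto
  then have t: "(\<lambda>n. t (r n)) \<longlonglongrightarrow> 1/3"
    using LIMSEQ_subseq_LIMSEQ[OF _ r(1), of t "1/3"] by (simp add: o_def)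
  have "circle_coloring (1/3) G f"
    unfolding circle_coloring_def
  proof (intro conjI allI ballI impI)
    fix v show "0 \<le> f v" "f v \<le> 1"
      using X(1) by (auto intro!: LIMSEQ_le_const[OF f[of v]] LIMSEQ_le_const2[OF f[of v]] simp: circle_coloring_def)
  next
    fix e u v assume e: "e \<in> edges G" "ends G e = Upair u v"
    have d: "(\<lambda>n. \<bar>\<bar>X (r n) u - X (r n) v\<bar> - 1/2\<bar>) \<longlonglongrightarrow> \<bar>\<bar>f u - f v\<bar> - 1/2\<bar>"
      by (intro tendsto_intros f)
    have X': "if signature G e = Positive then \<bar>\<bar>X n u - X n v\<bar> - 1/2\<bar> \<le> 1/2 - t n
      else t n \<le> \<bar>\<bar>X n u - X n v\<bar> - 1/2\<bar>" for n
      using X(1)[of n] e by (force simp: circle_coloring_def)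
    show "if signature G e = Positive then \<bar>\<bar>f u - f v\<bar> - 1/2\<bar> \<le> 1/2 - 1/3 else 1/3 \<le> \<bar>\<bar>f u - f v\<bar> - 1/2\<bar>"
    proof (cases "signature G e = Positive")
      case True
      have "(\<lambda>n. 1/2 - t (r n)) \<longlonglongrightarrow> 1/2 - 1/3" by (intro tendsto_intros t)
      with d have "\<bar>\<bar>f u - f v\<bar> - 1/2\<bar> \<le> 1/2 - 1/3" by (rule LIMSEQ_le) (use X' True in auto)
      then show ?thesis using True by simp
    next
      case False
      from t d have "1/3 \<le> \<bar>\<bar>f u - f v\<bar> - 1/2\<bar>" by (rule LIMSEQ_le) (use X' False in auto)
      then show ?thesis using False by simp
    qed
  qed
  then show ?thesis by (rule colorable_of_circle_coloring)
qed

theorem theorem1p2: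
  fixes G :: "('v, 'e) signed_graph"
  assumes "finite_signed_graph G"
    and "\<not> has_digon G"
    and "\<not> has_positive_loop G"
    and "circular_critical 3 G"
  shows "real (card (edges G)) \<ge> (3 * real (card (verts G)) - 1) / 2"
proof -
  define m where "m = to_edge G"
  let ?E = "m ` edges G"
  have nc: "\<not> colorable ?E"
    using colorable_imp_chi_le_3[OF assms(3)] assms(4) by (auto simp: circular_critical_def m_def)
  have minus: "colorable (m ` (edges G - {e}))" if "e \<in> edges G" for e
  proof -
    let ?H = "G\<lparr>edges := edges G - {e}\<rparr>"
    have "finite_signed_graph ?H" using assms(1) by (auto simp: finite_signed_graph_def)
    moreover from this have "proper_subgraph ?H G" using that by (auto simp: proper_subgraph_def subgraph_def)
    then have "circular_chromatic_number ?H \<le> 3" using assms(4) by (simp add: circular_critical_def)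
    ultimately have "colorable (to_edge ?H ` edges ?H)" by (rule chi_le_3_imp_colorable)
    moreover have "to_edge ?H = m" by (auto simp: to_edge_def m_def)
    ultimately show ?thesis by simp
  qed
  \<comment> \<open>If two edges had the same image, deleting one would leave the image unchanged
    and hence not colourable.\<close>
  have inj: "inj_on m (edges G)"
  proof (rule inj_onI, rule ccontr)
    fix e f assume ef: "e \<in> edges G" "f \<in> edges G" "m e = m f" "e \<noteq> f"
    have "m g \<in> m ` (edges G - {e})" if "g \<in> edges G" for g
    proof (cases "g = e")
      case True
      then show ?thesis using ef by auto
    qed (use that in simp)
    then have "?E \<subseteq> m ` (edges G - {e})" by blast
    then show False using colorable_mono[OF minus[OF ef(1)]] nc by simp
  qed
  have ll: "loopless ?E"
    unfolding loopless_def
  proof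
    fix e' assume "e' \<in> ?E"
    then obtain e where e: "e \<in> edges G" "e' = m e" by auto
    obtain u v where uv: "ends G e = Upair u v" by (cases "ends G e") auto
    \<comment> \<open>The image of a loop imposes no condition, so the graph would stay uncolourable
      without it.\<close>
    have "u \<noteq> v"
    proof
      assume "u = v"
      then have "ok \<phi> (m e)" for \<phi> using uv by (simp add: ok_def m_def to_edge_def)
      moreover obtain \<phi> where "sat \<phi> (m ` (edges G - {e}))" using minus[OF e(1)] by (auto simp: colorable_def)
      ultimately have "sat \<phi> ?E" by (auto simp: sat_def)
      then show False using nc by (auto simp: colorable_def)
    qed
    then show "card (ext e') = 2" using e uv by (simp add: m_def to_edge_def)
  qed
  have crit: "critical ?E"
    unfolding critical_def
  proof (intro conjI ballI)
    show "finite ?E" using assms(1) by (simp add: finite_signed_graph_def)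
    fix e' assume "e' \<in> ?E"
    then obtain e where e: "e \<in> edges G" "e' = m e" by auto
    then have "?E - {e'} \<subseteq> m ` (edges G - {e})" by auto
    then show "colorable (?E - {e'})" using minus[OF e(1)] colorable_mono by blast
  qed (use ll nc in auto)
  have nd: "\<not> is_digon ?E"
  proof
    assume "is_digon ?E"
    then obtain u v where "?E = {Edge True True {u, v}, Edge True False {u, v}}" by (auto simp: is_digon_def)
    then have "Edge True True {u, v} \<in> ?E" "Edge True False {u, v} \<in> ?E" by auto
    then obtain e f where "e \<in> edges G" "f \<in> edges G" "m e = Edge True True {u, v}" "m f = Edge True False {u, v}"
      by (metis imageE)
    then have "e \<in> edges G" "f \<in> edges G" "ends G e = ends G f" "signature G e \<noteq> signature G f"
      by (auto simp: m_def to_edge_def set_uprod_eq)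
    then show False using assms(2) unfolding has_digon_def by blast
  qed
  \<comment> \<open>An isolated vertex could be deleted without touching the edges; here criticality
    is applied to a vertex deletion.\<close>
  have vs: "vset ?E = verts G"
  proof
    show "vset ?E \<subseteq> verts G" using assms(1) by (auto simp: vset_def m_def to_edge_def finite_signed_graph_def)
    show "verts G \<subseteq> vset ?E"
    proof (rule ccontr)
      assume "\<not> verts G \<subseteq> vset ?E"
      then obtain v where v: "v \<in> verts G" "v \<notin> vset ?E" by auto
      let ?H = "G\<lparr>verts := verts G - {v}\<rparr>"
      have "finite_signed_graph ?H"
        using assms(1) v by (auto simp: finite_signed_graph_def vset_def m_def to_edge_def)
      moreover from this have "proper_subgraph ?H G" using v by (auto simp: proper_subgraph_def subgraph_def)
      then have "circular_chromatic_number ?H \<le> 3" using assms(4) by (simp add: circular_critical_def)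
      ultimately have "colorable (to_edge ?H ` edges ?H)" by (rule chi_le_3_imp_colorable)
      moreover have "to_edge ?H = m" by (auto simp: to_edge_def m_def)
      ultimately show False using nc by simp
    qed
  qed
  have "weight ?E = 2 * int (card (edges G))"
    unfolding weight_def sum.reindex[OF inj] by (simp add: m_def to_edge_def)
  moreover have "rho ?E (vset ?E) \<le> 1" by (rule critical_rho_le_1[OF crit nd])
  ultimately have "3 * int (card (verts G)) - 2 * int (card (edges G)) \<le> 1"
    using rho_vset[of ?E] unfolding vs by linarith
  then have "3 * real (card (verts G)) - 2 * real (card (edges G)) \<le> 1" by linarith
  then show ?thesis by simp
qed

end
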